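(* Let $G$ be a complex Lie group and let $F$ be a left invariant complex Finsler metric on $G$. Then $F$ is complex Berwald: in every holomorphic local chart, all the functions $\Gamma^i_{j;k}$ are independent of the fiber coordinate $w$.
   Context: Conventions: repeated indices are summed. $M$ is a complex manifold of complex dimension $n>0$; for a holomorphic local coordinate $z=(z^1,\dots,z^n)$ on $M$, $(z,w)=(z^1,\dots,z^n,w^1,\dots,w^n)$ denotes the induced holomorphic coordinate on the holomorphic tangent bundle $T^{1,0}M$, representing $w^i\partial_{z^i}\in T^{1,0}_zM$. $T^{1,0}M\setminus 0$ is the complement of the zero section. A complex Finsler metric on $M$ is a continuous function $F:T^{1,0}M\to[0,+\infty)$ such that: (1) $F$ is positive and smooth on $T^{1,0}M\setminus 0$; (2) $F(z,\lambda w)=|\lambda|F(z,w)$ for all $(z,w)\in T^{1,0}M$, $\lambda\in\mathbb{C}$; (3) (pseudo-convexity) with $\mathrm{G}=F^2$, the complex Hessian $(\mathrm{G}_{i\overline{j}})=(\partial_{w^i}\partial_{\overline{w}^j}\mathrm{G})$ is positive definite at every point of $T^{1,0}M\setminus 0$. $(\mathrm{G}^{\overline{i}j})$ is the inverse matrix: $\mathrm{G}_{k\overline{j}}\mathrm{G}^{\overline{j}i}=\delta^i_k$. On $T^{1,0}M\setminus0$ put $N^i_k=\mathrm{G}^{\overline{j}i}\,\partial_{\overline{w}^j}\partial_{z^k}\mathrm{G}$ and $\Gamma^i_{j;k}=\partial_{w^j}N^i_k$. A complex Lie group is a complex manifold with a group structure whose multiplication and inversion are holomorphic. A complex Finsler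 metric $F$ on $G$ is left invariant if $F((L_g)_*w)=F(w)$ for all $g\in G$ and $w\in T^{1,0}G$, where $L_g(g')=gg'$. *)

theory Defs
  imports "HOL-Analysis.Analysis" "HOL-Algebra.Group"
begin

section \<open>Complex manifolds of dimension \<open>CARD('n)\<close>\<close>

text \<open>Holomorphy of a map of several complex variables on an \<^emph>\<open>open\<close> set \<open>S\<close>: complex
  differentiability, i.e. the real Frechet derivative exists and is complex linear.\<close>

definition vec_holomorphic_on :: "(complex^'m::finite \<Rightarrow> complex^'n::finite) \<Rightarrow> (complex^'m) set \<Rightarrow> bool"
  where "vec_holomorphic_on f S \<longleftrightarrow>
    (\<forall>z\<in>S. \<exists>f'. (f has_derivative f') (at z) \<and> (\<forall>a v. f' (a *s v) = a *s f' v))"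

text \<open>A chart is a pair of a domain and a coordinate map; values of the coordinate map outside
  the domain are irrelevant.\<close>

type_synonym ('a, 'n) chart = "'a set \<times> ('a \<Rightarrow> complex^'n)"

definition chart_image :: "('a, 'n::finite) chart \<Rightarrow> (complex^'n) set"
  where "chart_image c = snd c ` fst c"

definition chart_inv :: "('a, 'n::finite) chart \<Rightarrow> complex^'n \<Rightarrow> 'a"
  where "chart_inv c = inv_into (fst c) (snd c)"

definition is_chart :: "'a topology \<Rightarrow> ('a, 'n::finite) chart \<Rightarrow> bool"
  where "is_chart X c \<longleftrightarrow> openin X (fst c) \<and> open (chart_image c) \<and>
    homeomorphic_map (subtopology X (fst c)) (top_of_set (chart_image c)) (snd c)"

definition transition :: "('a, 'n::finite) chart \<Rightarrow> ('a, 'n) chart \<Rightarrow> complex^'n \<Rightarrow> complex^'n"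
  where "transition c d = snd d \<circ> chart_inv c"

definition compatible :: "('a, 'n::finite) chart \<Rightarrow> ('a, 'n) chart \<Rightarrow> bool"
  where "compatible c d \<longleftrightarrow>
    vec_holomorphic_on (transition c d) (snd c ` (fst c \<inter> fst d)) \<and>
    vec_holomorphic_on (transition d c) (snd d ` (fst c \<inter> fst d))"

definition complex_manifold :: "'a topology \<Rightarrow> ('a, 'n::finite) chart set \<Rightarrow> bool"
  where "complex_manifold X A \<longleftrightarrow> Hausdorff_space X \<and> second_countable X \<and>
    (\<forall>c\<in>A. is_chart X c) \<and> (\<Union>c\<in>A. fst c) = topspace X \<and> (\<forall>c\<in>A. \<forall>d\<in>A. compatible c d)"

text \<open>All holomorphic local charts, i.e. the maximal atlas generated by \<open>A\<close>.\<close>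

definition holomorphic_charts :: "'a topology \<Rightarrow> ('a, 'n::finite) chart set \<Rightarrow> ('a, 'n) chart set"
  where "holomorphic_charts X A = {c. is_chart X c \<and> (\<forall>d\<in>A. compatible c d)}"

definition charts_at :: "'a topology \<Rightarrow> ('a, 'n::finite) chart set \<Rightarrow> 'a \<Rightarrow> ('a, 'n) chart set"
  where "charts_at X A p = {c \<in> holomorphic_charts X A. p \<in> fst c}"

definition holomorphic_map :: "'a topology \<Rightarrow> ('a, 'm::finite) chart set \<Rightarrow>
    'b topology \<Rightarrow> ('b, 'n::finite) chart set \<Rightarrow> ('a \<Rightarrow> 'b) \<Rightarrow> bool"
  where "holomorphic_map X A Y B f \<longleftrightarrow> continuous_map X Y f \<and>
    (\<forall>c\<in>A. \<forall>d\<in>B. vec_holomorphic_on (snd d \<circ> f \<circ> chart_inv c) (snd c ` (fst c \<inter> f -` fst d)))"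

definition prod_chart :: "('a, 'm::finite) chart \<Rightarrow> ('b, 'n::finite) chart \<Rightarrow> ('a \<times> 'b, 'm + 'n) chart"
  where "prod_chart c d = (fst c \<times> fst d,
    \<lambda>(x, y). \<chi> k. case k of Inl i \<Rightarrow> snd c x $ i | Inr j \<Rightarrow> snd d y $ j)"

definition prod_atlas :: "('a, 'm::finite) chart set \<Rightarrow> ('b, 'n::finite) chart set \<Rightarrow> ('a \<times> 'b, 'm + 'n) chart set"
  where "prod_atlas A B = {prod_chart c d | c d. c \<in> A \<and> d \<in> B}"

definition complex_Lie_group ::
    "('a, 'b) monoid_scheme \<Rightarrow> 'a topology \<Rightarrow> ('a, 'n::finite) chart set \<Rightarrow> bool"
  where "complex_Lie_group G X A \<longleftrightarrow> group G \<and> topspace X = carrier G \<and> complex_manifold X A \<and>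
    holomorphic_map (prod_topology X X) (prod_atlas A A) X A (\<lambda>(x, y). x \<otimes>\<^bsub>G\<^esub> y) \<and>
    holomorphic_map X A X A (\<lambda>x. inv\<^bsub>G\<^esub> x)"

section \<open>The holomorphic tangent bundle\<close>

text \<open>A tangent vector of type (1,0) at \<open>p\<close> is given by its components with respect to every
  holomorphic chart around \<open>p\<close>, transforming by the Jacobian of the coordinate changes (which is
  complex linear). Components with respect to pairs that are not charts around \<open>p\<close> are set to 0,
  so that equality of vectors is equality of functions.\<close>

type_synonym ('a, 'n) tvec = "'a \<times> (('a, 'n) chart \<Rightarrow> complex^'n)"

definition tangent_space ::
    "'a topology \<Rightarrow> ('a, 'n::finite) chart set \<Rightarrow> 'a \<Rightarrow> (('a, 'n) chart \<Rightarrow> complex^'n) set"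
  where "tangent_space X A p = {v.
    (\<forall>c\<in>charts_at X A p. \<forall>d\<in>charts_at X A p.
       v d = frechet_derivative (transition c d) (at (snd c p)) (v c)) \<and>
    (\<forall>c. c \<notin> charts_at X A p \<longrightarrow> v c = 0)}"

definition T10 :: "'a topology \<Rightarrow> ('a, 'n::finite) chart set \<Rightarrow> ('a, 'n) tvec set"
  where "T10 X A = Sigma (topspace X) (tangent_space X A)"

definition T10_nonzero :: "'a topology \<Rightarrow> ('a, 'n::finite) chart set \<Rightarrow> ('a, 'n) tvec set"
  where "T10_nonzero X A = {x \<in> T10 X A. snd x \<noteq> (\<lambda>_. 0)}"

definition tscale :: "complex \<Rightarrow> ('a, 'n::finite) tvec \<Rightarrow> ('a, 'n) tvec"
  where "tscale a x = (fst x, \<lambda>c. a *s snd x c)"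

text \<open>The vector \<open>w\<^sup>i \<partial>/\<partial>z\<^sup>i\<close> at the point with coordinate \<open>z\<close> in the
  chart \<open>c\<close>; this is the inverse of the induced coordinate system of the tangent bundle.\<close>

definition tvec_of_coords :: "'a topology \<Rightarrow> ('a, 'n::finite) chart set \<Rightarrow> ('a, 'n) chart \<Rightarrow>
    (complex^'n) \<times> (complex^'n) \<Rightarrow> ('a, 'n) tvec"
  where "tvec_of_coords X A c = (\<lambda>(z, w). (chart_inv c z,
    \<lambda>d. if d \<in> charts_at X A (chart_inv c z) then frechet_derivative (transition c d) (at z) w
        else 0))"

text \<open>The manifold topology of the tangent bundle, final with respect to the induced
  coordinate systems.\<close>

definition T10_topology :: "'a topology \<Rightarrow> ('a, 'n::finite) chart set \<Rightarrow> ('a, 'n) tvec topology"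
  where "T10_topology X A = topology (\<lambda>W. W \<subseteq> T10 X A \<and>
    (\<forall>c\<in>holomorphic_charts X A.
       open {x \<in> chart_image c \<times> UNIV. tvec_of_coords X A c x \<in> W}))"

lemma openin_T10_topology:
  "openin (T10_topology X A) W \<longleftrightarrow> W \<subseteq> T10 X A \<and>
    (\<forall>c\<in>holomorphic_charts X A.
       open {x \<in> chart_image c \<times> UNIV. tvec_of_coords X A c x \<in> W})"
proof -
  let ?P = "\<lambda>W. W \<subseteq> T10 X A \<and> (\<forall>c\<in>holomorphic_charts X A.
       open {x \<in> chart_image c \<times> UNIV. tvec_of_coords X A c x \<in> W})"
  have "istopology ?P"
    unfolding istopology_def
  proof (intro conjI allI impI ballI)
    fix S T c assume S: "?P S" and T: "?P T" and c: "c \<in> holomorphic_charts X A"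
    have "{x \<in> chart_image c \<times> UNIV. tvec_of_coords X A c x \<in> S \<inter> T} =
        {x \<in> chart_image c \<times> UNIV. tvec_of_coords X A c x \<in> S} \<inter>
        {x \<in> chart_image c \<times> UNIV. tvec_of_coords X A c x \<in> T}" by blast
    then show "open {x \<in> chart_image c \<times> UNIV. tvec_of_coords X A c x \<in> S \<inter> T}"
      using S T c by (simp add: open_Int)
  next
    fix K c assume K: "\<forall>S\<in>K. ?P S" and c: "c \<in> holomorphic_charts X A"
    have "{x \<in> chart_image c \<times> UNIV. tvec_of_coords X A c x \<in> \<Union>K} =
        (\<Union>S\<in>K. {x \<in> chart_image c \<times> UNIV. tvec_of_coords X A c x \<in> S})" by blast
    then show "open {x \<in> chart_image c \<times> UNIV. tvec_of_coords X A c x \<in> \<Union>K}"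
      using K c by (simp add: open_UN)
  qed blast+
  then show ?thesis by (simp add: T10_topology_def topology_inverse')
qed

text \<open>The differential of a map of manifolds. The components of the image do not depend on the
  auxiliary chart \<open>c\<close> around the base point when \<open>f\<close> is holomorphic.\<close>

definition pushforward :: "'a topology \<Rightarrow> ('a, 'm::finite) chart set \<Rightarrow>
    'b topology \<Rightarrow> ('b, 'n::finite) chart set \<Rightarrow> ('a \<Rightarrow> 'b) \<Rightarrow> ('a, 'm) tvec \<Rightarrow> ('b, 'n) tvec"
  where "pushforward X A Y B f x = (f (fst x),
    \<lambda>d. if d \<in> charts_at Y B (f (fst x)) then
          (let c = (SOME c. c \<in> charts_at X A (fst x)) in
             frechet_derivative (snd d \<circ> f \<circ> chart_inv c) (at (snd c (fst x))) (snd x c))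
        else 0)"

section \<open>Complex Finsler metrics\<close>

text \<open>\<open>Ck_on k f S\<close> is meant for open \<open>S\<close> and finite-dimensional domain; differentiability is
  over the reals.\<close>

primrec Ck_on :: "nat \<Rightarrow> ('a::euclidean_space \<Rightarrow> 'b::real_normed_vector) \<Rightarrow> 'a set \<Rightarrow> bool"
  where
    "Ck_on 0 f S \<longleftrightarrow> continuous_on S f"
  | "Ck_on (Suc k) f S \<longleftrightarrow> (\<forall>x\<in>S. f differentiable (at x)) \<and>
       (\<forall>v. Ck_on k (\<lambda>x. frechet_derivative f (at x) v) S)"

definition smooth_on :: "('a::euclidean_space \<Rightarrow> 'b::real_normed_vector) \<Rightarrow> 'a set \<Rightarrow> bool"
  where "smooth_on f S \<longleftrightarrow> (\<forall>k. Ck_on k f S)"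

text \<open>Wirtinger derivatives with respect to \<open>z\<^sup>k\<close>, \<open>w\<^sup>k\<close> and the
  conjugate of \<open>w\<^sup>k\<close>, in terms of the real derivative in the directions
  \<open>axis k 1\<close> (real part) and \<open>axis k \<i>\<close> (imaginary part).\<close>

definition d_z :: "'n \<Rightarrow> ((complex^'n::finite) \<times> (complex^'n) \<Rightarrow> complex) \<Rightarrow>
    (complex^'n) \<times> (complex^'n) \<Rightarrow> complex"
  where "d_z k f x = (frechet_derivative f (at x) (axis k 1, 0)
    - \<i> * frechet_derivative f (at x) (axis k \<i>, 0)) / 2"

definition d_w :: "'n \<Rightarrow> ((complex^'n::finite) \<times> (complex^'n) \<Rightarrow> complex) \<Rightarrow>
    (complex^'n) \<times> (complex^'n) \<Rightarrow> complex"
  where "d_w k f x = (frechet_derivative f (at x) (0, axis k 1)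
    - \<i> * frechet_derivative f (at x) (0, axis k \<i>)) / 2"

definition d_wbar :: "'n \<Rightarrow> ((complex^'n::finite) \<times> (complex^'n) \<Rightarrow> complex) \<Rightarrow>
    (complex^'n) \<times> (complex^'n) \<Rightarrow> complex"
  where "d_wbar k f x = (frechet_derivative f (at x) (0, axis k 1)
    + \<i> * frechet_derivative f (at x) (0, axis k \<i>)) / 2"

text \<open>Local expression of \<open>F\<^sup>2\<close>.\<close>

definition loc_G :: "'a topology \<Rightarrow> ('a, 'n::finite) chart set \<Rightarrow> (('a, 'n) tvec \<Rightarrow> real) \<Rightarrow>
    ('a, 'n) chart \<Rightarrow> (complex^'n) \<times> (complex^'n) \<Rightarrow> complex"
  where "loc_G X A F c x = complex_of_real ((F (tvec_of_coords X A c x))\<^sup>2)"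

definition levi_matrix :: "'a topology \<Rightarrow> ('a, 'n::finite) chart set \<Rightarrow> (('a, 'n) tvec \<Rightarrow> real) \<Rightarrow>
    ('a, 'n) chart \<Rightarrow> (complex^'n) \<times> (complex^'n) \<Rightarrow> complex^'n^'n"
  where "levi_matrix X A F c x = (\<chi> i j. d_w i (d_wbar j (loc_G X A F c)) x)"

definition hermitian_pos_def :: "complex^'n::finite^'n \<Rightarrow> bool"
  where "hermitian_pos_def H \<longleftrightarrow> (\<forall>i j. H $ j $ i = cnj (H $ i $ j)) \<and>
    (\<forall>v. v \<noteq> 0 \<longrightarrow> 0 < Re (\<Sum>i\<in>UNIV. \<Sum>j\<in>UNIV. H $ i $ j * v $ i * cnj (v $ j)))"

definition complex_Finsler_metric ::
    "'a topology \<Rightarrow> ('a, 'n::finite) chart set \<Rightarrow> (('a, 'n) tvec \<Rightarrow> real) \<Rightarrow> bool"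
  where "complex_Finsler_metric X A F \<longleftrightarrow>
    (\<forall>x\<in>T10 X A. 0 \<le> F x) \<and>
    continuous_map (T10_topology X A) euclideanreal F \<and>
    (\<forall>x\<in>T10_nonzero X A. 0 < F x) \<and>
    (\<forall>c\<in>holomorphic_charts X A.
       smooth_on (F \<circ> tvec_of_coords X A c) (chart_image c \<times> (- {0}))) \<and>
    (\<forall>x\<in>T10 X A. \<forall>a. F (tscale a x) = cmod a * F x) \<and>
    (\<forall>c\<in>holomorphic_charts X A. \<forall>z\<in>chart_image c. \<forall>w. w \<noteq> 0 \<longrightarrow>
       hermitian_pos_def (levi_matrix X A F c (z, w)))"

definition left_invariant :: "('a, 'b) monoid_scheme \<Rightarrow> 'a topology \<Rightarrow>
    ('a, 'n::finite) chart set \<Rightarrow> (('a, 'n) tvec \<Rightarrow> real) \<Rightarrow> bool"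
  where "left_invariant G X A F \<longleftrightarrow>
    (\<forall>g\<in>carrier G. \<forall>x\<in>T10 X A. F (pushforward X A X A (\<lambda>h. g \<otimes>\<^bsub>G\<^esub> h) x) = F x)"

text \<open>Since the levi matrix \<open>H\<close> has entries \<open>H $ k $ j\<close> with \<open>j\<close> the conjugate index, the
  coefficient with upper indices (conjugate \<open>j\<close>, \<open>i\<close>) is the entry \<open>$ j $ i\<close> of its inverse.\<close>

definition N_coeff :: "'a topology \<Rightarrow> ('a, 'n::finite) chart set \<Rightarrow> (('a, 'n) tvec \<Rightarrow> real) \<Rightarrow>
    ('a, 'n) chart \<Rightarrow> 'n \<Rightarrow> 'n \<Rightarrow> (complex^'n) \<times> (complex^'n) \<Rightarrow> complex"
  where "N_coeff X A F c i k x = (\<Sum>j\<in>UNIV.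
    matrix_inv (levi_matrix X A F c x) $ j $ i * d_wbar j (d_z k (loc_G X A F c)) x)"

text \<open>\<open>Gamma_coeff X A F c i j k\<close> has upper index \<open>i\<close> and lower indices \<open>j; k\<close>.\<close>

definition Gamma_coeff :: "'a topology \<Rightarrow> ('a, 'n::finite) chart set \<Rightarrow> (('a, 'n) tvec \<Rightarrow> real) \<Rightarrow>
    ('a, 'n) chart \<Rightarrow> 'n \<Rightarrow> 'n \<Rightarrow> 'n \<Rightarrow> (complex^'n) \<times> (complex^'n) \<Rightarrow> complex"
  where "Gamma_coeff X A F c i j k = d_w j (N_coeff X A F c i k)"

definition complex_Berwald ::
    "'a topology \<Rightarrow> ('a, 'n::finite) chart set \<Rightarrow> (('a, 'n) tvec \<Rightarrow> real) \<Rightarrow> bool"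
  where "complex_Berwald X A F \<longleftrightarrow>
    (\<forall>c\<in>holomorphic_charts X A. \<forall>i j k. \<forall>z\<in>chart_image c. \<forall>w w'. w \<noteq> 0 \<longrightarrow> w' \<noteq> 0 \<longrightarrow>
       Gamma_coeff X A F c i j k (z, w) = Gamma_coeff X A F c i j k (z, w'))"

end

theory Submission
  imports Defs "HOL-Complex_Analysis.Cauchy_Integral_Formula"
begin

text \<open>In a chart around \<open>p\<^sub>0 = p(z\<^sub>0)\<close>, the left translations by \<open>p(z) p\<^sub>0\<^sup>-\<^sup>1\<close> have differentials
  \<open>B(z)\<close> at \<open>z\<^sub>0\<close> that depend holomorphically on \<open>z\<close>, with \<open>B(z\<^sub>0) = 1\<close>, and left invariance reads
  \<open>G(z, B(z) w) = G(z\<^sub>0, w)\<close>. Differentiating in \<open>z\<^sup>k\<close> at \<open>z\<^sub>0\<close> gives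
  \<open>\<partial>\<^sub>z\<^sub>k G = - (C w)\<^sup>i \<partial>\<^sub>w\<^sub>i G\<close> with the constant matrix \<open>C = \<partial>\<^sub>k B(z\<^sub>0)\<close>. A further derivative in the conjugate
  of \<open>w\<^sup>j\<close> and multiplication by the inverse of the Levi matrix yield \<open>N\<^sup>i\<^sub>k = - (C w)\<^sup>i\<close>, which is linear
  in \<open>w\<close>.\<close>

section \<open>Several complex variables\<close>

text \<open>Two obstacles shape the argument. First, holomorphy here is complex differentiability at
  each point, so \<open>B(z)\<close>, itself a derivative in a second variable, is not visibly
  differentiable in \<open>z\<close>. Restricting both variables to complex lines leaves a jointly
  continuous, separately holomorphic function of two complex numbers, and Cauchy estimates then
  yield the mixed derivative. Holomorphy in \<open>z\<close> comes from right translations, because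
  \<open>z\<close> enters the product \<open>p(z) p(z0)^-1 p(y)\<close> in the left factor. It is
  what makes the velocity of \<open>B(z) w\<close> complex linear in the direction of
  \<open>z\<close>; otherwise derivatives of \<open>G\<close> in the conjugate of \<open>w\<close>
  would enter the formula for its \<open>z\<close>-derivative. Second, \<open>C\<close> is found for
  one \<open>z0\<close> at a time, so \<open>N\<close> is known to be linear in \<open>w\<close> on
  a single fiber only. But \<open>d_w\<close> is read off from the total derivative in
  \<open>(z, w)\<close>, and \<open>frechet_derivative\<close> is an unspecified value where that
  derivative does not exist. So \<open>N\<close> has to be shown differentiable in all variables,
  through the inverse of the Levi matrix, before its formula on the fiber may be
  differentiated.\<close>

lemma second_order_Taylor_bound:
  assumes hol: "f holomorphic_on ball 0 R" and r: "0 < r" "2 * r < R"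
    and M: "\<And>s. s \<in> cball 0 (2 * r) \<Longrightarrow> cmod (f s) < M"
    and s: "cmod s \<le> r"
  shows "cmod (f s - f 0 - deriv f 0 * s) \<le> 2 * M / r\<^sup>2 * (cmod s)\<^sup>2"
proof -
  \<comment> \<open>Cauchy's estimate on the disc of radius \<open>r\<close> about \<open>u\<close>,
    which stays inside \<open>cball 0 (2 * r)\<close>, where \<open>f\<close> is bounded by
    \<open>M\<close>; the factor 2 is \<open>fact 2\<close>.\<close>
  have bd: "cmod ((deriv ^^ 2) f u) \<le> 2 * M / r\<^sup>2" if u: "u \<in> cball 0 r" for u
  proof -
    have sub: "cball u r \<subseteq> cball 0 (2 * r)"
    proof
      fix x assume "x \<in> cball u r"
      then show "x \<in> cball 0 (2 * r)"
        using u norm_triangle_sub[of x u] by (auto simp: dist_norm norm_minus_commute)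
    qed
    then have sub': "cball u r \<subseteq> ball 0 R" using r by force
    have "cmod ((deriv ^^ 2) f u) \<le> fact 2 * M / r^2"
    proof (rule Cauchy_higher_deriv_bound[where y = 0])
      show "f holomorphic_on ball u r"
        using hol sub' ball_subset_cball holomorphic_on_subset by blast
      show "continuous_on (cball u r) f"
        using hol sub' holomorphic_on_imp_continuous_on continuous_on_subset by blast
      show "\<And>w. w \<in> ball u r \<Longrightarrow> f w \<in> ball 0 M"
        using M sub ball_subset_cball by (force simp: dist_norm)
    qed (use r in auto)
    then show ?thesis by (simp add: fact_numeral)
  qed
  \<comment> \<open>The remainder in \<open>complex_Taylor\<close> is divided by
    \<open>fact n\<close> and not by \<open>fact (Suc n)\<close>, so the constant remains
    \<open>2 * M / r^2\<close>.\<close>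
  have "cmod ((deriv ^^ 0) f s - (\<Sum>i\<le>1. (deriv ^^ i) f 0 * (s - 0) ^ i / fact i))
      \<le> (2 * M / r\<^sup>2) * cmod (s - 0) ^ Suc 1 / fact 1"
  proof (rule complex_Taylor[where S = "cball 0 r" and n = 1 and f = "\<lambda>i. (deriv ^^ i) f"])
    show "((deriv ^^ i) f has_field_derivative (deriv ^^ Suc i) f x) (at x within cball 0 r)"
      if "x \<in> cball 0 r" for i x
    proof -
      have "(deriv ^^ i) f holomorphic_on ball 0 R"
        by (rule holomorphic_higher_deriv[OF hol]) auto
      moreover have "x \<in> ball 0 R" using that r by auto
      ultimately have "((deriv ^^ i) f has_field_derivative deriv ((deriv ^^ i) f) x) (at x)"
        by (intro holomorphic_derivI[where S = "ball 0 R"]) auto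
      then show ?thesis by (auto intro: has_field_derivative_at_within)
    qed
    show "cmod ((deriv ^^ Suc 1) f x) \<le> 2 * M / r\<^sup>2" if "x \<in> cball 0 r" for x
      using bd[OF that] by (simp add: numeral_2_eq_2)
  qed (use r s in auto)
  moreover have "(\<Sum>i\<le>1. (deriv ^^ i) f 0 * (s - 0) ^ i / fact i) = f 0 + deriv f 0 * s"
    by (simp add: atMost_Suc)
  ultimately show ?thesis by (simp add: numeral_2_eq_2 algebra_simps)
qed

text \<open>The derivative in the second variable is a locally uniform limit of difference quotients,
  each of which is holomorphic in the first variable.\<close>

lemma deriv_depends_holomorphically:
  fixes \<psi> :: "complex \<Rightarrow> complex \<Rightarrow> complex"
  assumes R: "0 < R"
    and cont: "continuous_on (ball 0 R \<times> ball 0 R) (\<lambda>x. \<psi> (fst x) (snd x))"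
    and hol2: "\<And>t. t \<in> ball 0 R \<Longrightarrow> \<psi> t holomorphic_on ball 0 R"
    and hol1: "\<And>s. s \<in> ball 0 R \<Longrightarrow> (\<lambda>t. \<psi> t s) holomorphic_on ball 0 R"
  shows "(\<lambda>t. deriv (\<psi> t) 0) field_differentiable at 0"
proof -
  define r where "r = R / 4"
  have r: "0 < r" "2 * r < R" using R by (auto simp: r_def)
  have sub: "cball 0 (2 * r) \<subseteq> ball (0::complex) R" using r by auto
  have "compact ((\<lambda>x. \<psi> (fst x) (snd x)) ` (cball 0 (2 * r) \<times> cball 0 (2 * r)))"
    using sub by (intro compact_continuous_image continuous_on_subset[OF cont] compact_Times) auto
  then obtain M where "\<forall>y \<in> (\<lambda>x. \<psi> (fst x) (snd x)) ` (cball 0 (2 * r) \<times> cball 0 (2 * r)). cmod y < M"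
    using compact_imp_bounded bounded_pos_less by blast
  then have M: "\<And>t s. t \<in> cball 0 (2 * r) \<Longrightarrow> s \<in> cball 0 (2 * r) \<Longrightarrow> cmod (\<psi> t s) < M" by auto
  define \<epsilon> :: "nat \<Rightarrow> complex" where "\<epsilon> n = of_real (r / real (Suc n))" for n
  have e: "cmod (\<epsilon> n) = r / real (Suc n)" "cmod (\<epsilon> n) \<le> r" "\<epsilon> n \<noteq> 0" for n
    using r by (auto simp: \<epsilon>_def norm_divide divide_simps simp del: of_nat_Suc)
  define q where "q n t = (\<psi> t (\<epsilon> n) - \<psi> t 0) / \<epsilon> n" for n t
  have "(\<lambda>t. deriv (\<psi> t) 0) holomorphic_on ball 0 r"
  proof (rule holomorphic_uniform_sequence[where f = q])
    show "q n holomorphic_on ball 0 r" for n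
      unfolding q_def
      using e[of n] r
      by (intro holomorphic_intros holomorphic_on_subset[OF hol1]) auto
    fix x :: complex assume "x \<in> ball 0 r"
    then obtain d where d: "0 < d" "cball x d \<subseteq> ball 0 r"
      using open_contains_cball open_ball by blast
    have "uniform_limit (cball x d) q (\<lambda>t. deriv (\<psi> t) 0) sequentially"
    proof (rule uniform_limitI)
      fix \<delta> :: real assume "0 < \<delta>"
      have "(\<lambda>n. 2 * M / r\<^sup>2 * (r / real (Suc n))) \<longlonglongrightarrow> 2 * M / r\<^sup>2 * 0"
        by (intro tendsto_intros LIMSEQ_Suc[OF lim_const_over_n])
      then have "\<forall>\<^sub>F n in sequentially. 2 * M / r\<^sup>2 * (r / real (Suc n)) < \<delta>"
        using \<open>0 < \<delta>\<close> by (intro order_tendstoD) auto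
      then show "\<forall>\<^sub>F n in sequentially. \<forall>t\<in>cball x d. dist (q n t) (deriv (\<psi> t) 0) < \<delta>"
      proof eventually_elim
        case (elim n)
        show ?case
        proof
          fix t assume "t \<in> cball x d"
          then have t: "cmod t < r" using d by auto
          have "cmod (\<psi> t (\<epsilon> n) - \<psi> t 0 - deriv (\<psi> t) 0 * \<epsilon> n) \<le> 2 * M / r\<^sup>2 * (cmod (\<epsilon> n))\<^sup>2"
            using t r e[of n] M
            by (intro second_order_Taylor_bound[where R = R] hol2) auto
          moreover have "\<psi> t (\<epsilon> n) - \<psi> t 0 - deriv (\<psi> t) 0 * \<epsilon> n = (q n t - deriv (\<psi> t) 0) * \<epsilon> n"
            using e(3)[of n] by (simp add: q_def field_simps)
          ultimately have "cmod (q n t - deriv (\<psi> t) 0) * cmod (\<epsilon> n)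
              \<le> (2 * M / r\<^sup>2 * cmod (\<epsilon> n)) * cmod (\<epsilon> n)"
            by (simp add: norm_mult power2_eq_square mult.assoc)
          then have "cmod (q n t - deriv (\<psi> t) 0) \<le> 2 * M / r\<^sup>2 * cmod (\<epsilon> n)"
            using e(3)[of n] by (subst (asm) mult_le_cancel_right_pos) simp_all
          then show "dist (q n t) (deriv (\<psi> t) 0) < \<delta>"
            using elim by (simp add: dist_norm e(1))
        qed
      qed
    qed
    with d show "\<exists>d>0. cball x d \<subseteq> ball 0 r \<and> uniform_limit (cball x d) q (\<lambda>t. deriv (\<psi> t) 0) sequentially"
      by blast
  qed auto
  then show ?thesis
    using r by (auto intro: holomorphic_on_imp_differentiable_at)
qed

text \<open>A pointwise notion, so that chart changes can be composed at one point; an open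
  neighbourhood matters only when a derivative passes to a map that agrees locally.\<close>

definition complex_diff_at :: "(complex^'m::finite \<Rightarrow> complex^'n::finite) \<Rightarrow> complex^'m \<Rightarrow> bool"
  where "complex_diff_at f z \<longleftrightarrow> (\<exists>f'. (f has_derivative f') (at z) \<and> (\<forall>a v. f' (a *s v) = a *s f' v))"

lemma vec_holomorphic_onD: "vec_holomorphic_on f S \<Longrightarrow> z \<in> S \<Longrightarrow> complex_diff_at f z"
  by (simp add: vec_holomorphic_on_def complex_diff_at_def)

lemma complex_diff_at_derivative:
  assumes "complex_diff_at f z"
  shows "(f has_derivative frechet_derivative f (at z)) (at z)"
    and "frechet_derivative f (at z) (a *s v) = a *s frechet_derivative f (at z) v"
proof -
  obtain f' where f': "(f has_derivative f') (at z)" "\<forall>a v. f' (a *s v) = a *s f' v"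
    using assms complex_diff_at_def by blast
  with frechet_derivative_at[OF f'(1)]
  show "(f has_derivative frechet_derivative f (at z)) (at z)"
    and "frechet_derivative f (at z) (a *s v) = a *s frechet_derivative f (at z) v" by auto
qed

lemma complex_diff_at_compose:
  assumes "complex_diff_at f z" "complex_diff_at g (f z)"
  shows "complex_diff_at (g \<circ> f) z"
    and "frechet_derivative (g \<circ> f) (at z) v
      = frechet_derivative g (at (f z)) (frechet_derivative f (at z) v)"
proof -
  note d = diff_chain_at[OF complex_diff_at_derivative(1)[OF assms(1)]
      complex_diff_at_derivative(1)[OF assms(2)]]
  show "complex_diff_at (g \<circ> f) z"
    unfolding complex_diff_at_def
    by (intro exI conjI, rule d) (simp add: complex_diff_at_derivative(2)[OF assms(1)]
      complex_diff_at_derivative(2)[OF assms(2)])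
  show "frechet_derivative (g \<circ> f) (at z) v
      = frechet_derivative g (at (f z)) (frechet_derivative f (at z) v)"
    using frechet_derivative_at[OF d] by (metis comp_apply)
qed

lemma complex_diff_at_transform:
  assumes "complex_diff_at f z" "open S" "z \<in> S" "\<And>x. x \<in> S \<Longrightarrow> f x = g x"
  shows "complex_diff_at g z" and "frechet_derivative g (at z) = frechet_derivative f (at z)"
proof -
  have "(g has_derivative frechet_derivative f (at z)) (at z)"
    using has_derivative_transform_within_open[OF complex_diff_at_derivative(1)[OF assms(1)] assms(2,3)]
      assms(4) by blast
  then show "complex_diff_at g z" "frechet_derivative g (at z) = frechet_derivative f (at z)"
    using complex_diff_at_derivative(2)[OF assms(1)] frechet_derivative_at[symmetric]
    by (auto simp: complex_diff_at_def)
qed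

text \<open>Complex linearity reduces the derivative along a complex line to multiplication by one
  number. This is the passage to function theory of one variable.\<close>

lemma complex_diff_at_has_field_derivative:
  assumes "complex_diff_at f (z + t *s v)"
  shows "((\<lambda>t. f (z + t *s v) $ i) has_field_derivative
      frechet_derivative f (at (z + t *s v)) v $ i) (at t)"
proof -
  have l: "bounded_linear (\<lambda>t::complex. t *s v)"
    by (simp add: linear_conv_bounded_linear[symmetric] linear_iff vec_eq_iff algebra_simps)
  have "((\<lambda>t. z + t *s v) has_derivative (\<lambda>t. t *s v)) (at t)"
    using bounded_linear_imp_has_derivative[OF l] by (auto intro!: derivative_eq_intros)
  from has_derivative_compose[OF this complex_diff_at_derivative(1)[OF assms]]
  have "((\<lambda>t. f (z + t *s v)) has_derivative
      (\<lambda>t'. frechet_derivative f (at (z + t *s v)) (t' *s v))) (at t)" .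
  from bounded_linear.has_derivative[OF bounded_linear_vec_nth this]
  show ?thesis
    by (simp add: has_field_derivative_def complex_diff_at_derivative(2)[OF assms] mult.commute[of _ "_ $ i"]
       mult_commute_abs)
qed

section \<open>Smooth functions and Wirtinger derivatives\<close>

text \<open>The closure properties below compute a derivative by a formula that agrees with
  \<open>frechet_derivative\<close> on \<open>S\<close> only; this lemma carries regularity from the
  one to the other.\<close>

lemma Ck_on_cong:
  assumes "open S" "\<And>x. x \<in> S \<Longrightarrow> f x = g x" "Ck_on k f S"
  shows "Ck_on k g S"
  using assms(2,3)
proof (induction k arbitrary: f g)
  case 0
  then show ?case by (simp cong: continuous_on_cong)
next
  case (Suc k)
  have d: "(g has_derivative frechet_derivative f (at x)) (at x)" if "x \<in> S" for x
    using has_derivative_transform_within_open[of f _ x UNIV S g] assms(1) Suc.prems that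
    by (auto simp: frechet_derivative_works)
  then have "frechet_derivative f (at x) = frechet_derivative g (at x)" if "x \<in> S" for x
    using frechet_derivative_at that by blast
  moreover have "g differentiable at x" if "x \<in> S" for x
    using d that by (auto simp: differentiable_def)
  moreover have "Ck_on k (\<lambda>x. frechet_derivative f (at x) v) S" for v
    using Suc.prems by simp
  ultimately show ?case using Suc.IH[of "\<lambda>x. frechet_derivative f (at x) v" "\<lambda>x. frechet_derivative g (at x) v" for v]
    by simp
qed

lemma Ck_on_SucD: "Ck_on (Suc k) f S \<Longrightarrow> Ck_on k f S"
proof (induction k arbitrary: f)
  case 0
  then show ?case
    by (auto intro!: continuous_at_imp_continuous_on differentiable_imp_continuous_within)
qed auto

lemma Ck_on_bounded_linear:
  assumes "open S" "bounded_linear L" "Ck_on k f S"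
  shows "Ck_on k (\<lambda>x. L (f x)) S"
  using assms(3)
proof (induction k arbitrary: f)
  case 0
  then show ?case using assms(2) by (simp add: linear_continuous_on_compose linear_linear bounded_linear.continuous_on)
next
  case (Suc k)
  have d: "((\<lambda>x. L (f x)) has_derivative (\<lambda>v. L (frechet_derivative f (at x) v))) (at x)"
    if "x \<in> S" for x
    using Suc.prems that by (intro bounded_linear.has_derivative[OF assms(2)]) (auto simp: frechet_derivative_works)
  have e: "L (frechet_derivative f (at x) v) = frechet_derivative (\<lambda>x. L (f x)) (at x) v" if "x \<in> S" for x v
    using frechet_derivative_at[OF d[OF that]] by metis
  have "Ck_on k (\<lambda>x. L (frechet_derivative f (at x) v)) S" for v
    using Suc.prems by (intro Suc.IH) auto
  then have "Ck_on k (\<lambda>x. frechet_derivative (\<lambda>x. L (f x)) (at x) v) S" for v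
    by (rule Ck_on_cong[OF assms(1) e, rotated])
  with d show ?case by (auto simp: differentiable_def)
qed

lemma Ck_on_add:
  assumes "open S" "Ck_on k f S" "Ck_on k g S"
  shows "Ck_on k (\<lambda>x. f x + g x) S"
  using assms(2,3)
proof (induction k arbitrary: f g)
  case 0
  then show ?case by (simp add: continuous_on_add)
next
  case (Suc k)
  have d: "((\<lambda>x. f x + g x) has_derivative
      (\<lambda>v. frechet_derivative f (at x) v + frechet_derivative g (at x) v)) (at x)" if "x \<in> S" for x
    using Suc.prems that by (intro has_derivative_add) (auto simp: frechet_derivative_works)
  have e: "frechet_derivative f (at x) v + frechet_derivative g (at x) v
      = frechet_derivative (\<lambda>x. f x + g x) (at x) v" if "x \<in> S" for x v
    using frechet_derivative_at[OF d[OF that]] by metis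
  have "Ck_on k (\<lambda>x. frechet_derivative f (at x) v + frechet_derivative g (at x) v) S" for v
    using Suc.prems by (intro Suc.IH) auto
  then have "Ck_on k (\<lambda>x. frechet_derivative (\<lambda>x. f x + g x) (at x) v) S" for v
    by (rule Ck_on_cong[OF assms(1) e, rotated])
  with d show ?case by (auto simp: differentiable_def)
qed

lemma Ck_on_mult:
  fixes f g :: "'a::euclidean_space \<Rightarrow> 'b::real_normed_algebra"
  assumes "open S" "Ck_on k f S" "Ck_on k g S"
  shows "Ck_on k (\<lambda>x. f x * g x) S"
  using assms(2,3)
proof (induction k arbitrary: f g)
  case 0
  then show ?case by (simp add: continuous_on_mult)
next
  case (Suc k)
  have d: "((\<lambda>x. f x * g x) has_derivative
      (\<lambda>v. f x * frechet_derivative g (at x) v + frechet_derivative f (at x) v * g x)) (at x)"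
    if "x \<in> S" for x
    using Suc.prems that by (intro has_derivative_mult) (auto simp: frechet_derivative_works)
  have e: "f x * frechet_derivative g (at x) v + frechet_derivative f (at x) v * g x
      = frechet_derivative (\<lambda>x. f x * g x) (at x) v" if "x \<in> S" for x v
    using frechet_derivative_at[OF d[OF that]] by metis
  \<comment> \<open>Each term of the product rule keeps one undifferentiated factor, whose order has
    to be lowered to \<open>k\<close> before the induction hypothesis applies.\<close>
  have "Ck_on k (\<lambda>x. f x * frechet_derivative g (at x) v + frechet_derivative f (at x) v * g x) S" for v
    using Suc.prems Ck_on_SucD[OF Suc.prems(1)] Ck_on_SucD[OF Suc.prems(2)]
    by (intro Ck_on_add[OF assms(1)] Suc.IH) auto
  then have "Ck_on k (\<lambda>x. frechet_derivative (\<lambda>x. f x * g x) (at x) v) S" for v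
    by (rule Ck_on_cong[OF assms(1) e, rotated])
  with d show ?case by (auto simp: differentiable_def)
qed

lemma smooth_on_differentiable:
  assumes "smooth_on f S" "x \<in> S"
  shows "f differentiable at x"
proof -
  have "Ck_on (Suc 0) f S" using assms(1) by (simp only: smooth_on_def)
  with assms(2) show ?thesis by simp
qed

lemma smooth_on_frechet_derivative:
  assumes "smooth_on f S"
  shows "smooth_on (\<lambda>x. frechet_derivative f (at x) v) S"
  unfolding smooth_on_def
proof
  fix k
  have "Ck_on (Suc k) f S" using assms by (simp only: smooth_on_def)
  then show "Ck_on k (\<lambda>x. frechet_derivative f (at x) v) S" by simp
qed

lemma smooth_on_wirtinger:
  assumes "open S" "smooth_on f S"
  shows "smooth_on (d_z k f) S" "smooth_on (d_w k f) S" "smooth_on (d_wbar k f) S"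
proof -
  have *: "smooth_on (\<lambda>x. (frechet_derivative f (at x) u + a * frechet_derivative f (at x) v) / 2) S"
    for u v and a :: complex
  proof -
    have "Ck_on m (\<lambda>x. frechet_derivative f (at x) u + a * frechet_derivative f (at x) v) S" for m
      using smooth_on_frechet_derivative[OF assms(2)]
      by (intro Ck_on_add[OF assms(1)] Ck_on_bounded_linear[OF assms(1) bounded_linear_mult_right])
        (auto simp: smooth_on_def)
    from Ck_on_bounded_linear[OF assms(1) bounded_linear_divide this] show ?thesis
      by (simp add: smooth_on_def)
  qed
  show "smooth_on (d_z k f) S"
    using *[of _ "- \<i>"] by (simp add: d_z_def[abs_def])
  show "smooth_on (d_w k f) S"
    using *[of _ "- \<i>"] by (simp add: d_w_def[abs_def])
  show "smooth_on (d_wbar k f) S"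
    using * by (simp add: d_wbar_def[abs_def])
qed

lemma smooth_on_loc_G:
  fixes c :: "('a, 'n::finite) chart"
  assumes "open (chart_image c)" "smooth_on (F \<circ> tvec_of_coords X A c) (chart_image c \<times> (- {0}))"
  shows "smooth_on (loc_G X A F c) (chart_image c \<times> (- {0}))"
proof -
  have o: "open (chart_image c \<times> (- {0::complex^'n}))"
    using assms(1) by (intro open_Times) auto
  show ?thesis
    unfolding smooth_on_def loc_G_def[abs_def] power2_eq_square
    using assms(2)
    by (intro allI Ck_on_bounded_linear[OF o bounded_linear_of_real] Ck_on_mult[OF o])
      (auto simp: smooth_on_def comp_def)
qed

text \<open>Lets an identity that holds on one fiber determine the fiber part of the total
  derivative, provided that the total derivative exists.\<close>

lemma frechet_derivative_slice:
  assumes "f differentiable at (z, w)"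
    and "((\<lambda>w. f (z, w)) has_derivative D) (at w)"
  shows "frechet_derivative f (at (z, w)) (0, v) = D v"
proof -
  have "((\<lambda>w. (z, w)) has_derivative (\<lambda>v. (0, v))) (at w)"
    by (auto intro!: derivative_eq_intros)
  moreover have "(f has_derivative frechet_derivative f (at (z, w))) (at (z, w))"
    using assms(1) by (simp add: frechet_derivative_works)
  ultimately have "((\<lambda>w. f (z, w)) has_derivative (\<lambda>v. frechet_derivative f (at (z, w)) (0, v))) (at w)"
    by (rule has_derivative_compose)
  then show ?thesis using has_derivative_unique[OF _ assms(2)] by metis
qed

lemma d_w_cnj:
  assumes "f differentiable at x"
  shows "d_w i (\<lambda>x. cnj (f x)) x = cnj (d_wbar i f x)"
    and "d_wbar i (\<lambda>x. cnj (f x)) x = cnj (d_w i f x)"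
proof -
  have "((\<lambda>x. cnj (f x)) has_derivative (\<lambda>v. cnj (frechet_derivative f (at x) v))) (at x)"
    using assms by (intro bounded_linear.has_derivative[OF bounded_linear_cnj]) (simp add: frechet_derivative_works)
  from frechet_derivative_at[OF this, symmetric]
  show "d_w i (\<lambda>x. cnj (f x)) x = cnj (d_wbar i f x)"
    and "d_wbar i (\<lambda>x. cnj (f x)) x = cnj (d_w i f x)"
    by (simp_all add: d_w_def d_wbar_def)
qed

text \<open>For a real-valued function the mixed derivatives commute as soon as the Levi matrix is
  Hermitian, so Schwarz's theorem is not required.\<close>

lemma d_wbar_d_w_eq_levi:
  assumes S: "open S" "x \<in> S" and G: "smooth_on G S" "\<And>x. cnj (G x) = G x"
    and herm: "d_w j (d_wbar i G) x = cnj (d_w i (d_wbar j G) x)"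
  shows "d_wbar i (d_w j G) x = d_w j (d_wbar i G) x"
proof -
  have "d_wbar j G y = cnj (d_w j G y)" if "y \<in> S" for y
    using d_w_cnj(2)[OF smooth_on_differentiable[OF G(1) that], of j] G(2) by simp
  moreover have df: "(\<lambda>y. cnj (d_w j G y)) differentiable at x"
    using smooth_on_differentiable[OF smooth_on_wirtinger(2)[OF S(1) G(1)] S(2)]
    unfolding differentiable_def by (blast intro: bounded_linear.has_derivative[OF bounded_linear_cnj])
  ultimately have "frechet_derivative (\<lambda>y. cnj (d_w j G y)) (at x) = frechet_derivative (d_wbar j G) (at x)"
    using S by (intro frechet_derivative_transform_within_open[where X = S]) auto
  then have "d_w i (d_wbar j G) x = d_w i (\<lambda>y. cnj (d_w j G y)) x"
    by (simp only: d_w_def[of i])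
  also have "\<dots> = cnj (d_wbar i (d_w j G) x)"
    using d_w_cnj(1)[OF smooth_on_differentiable[OF smooth_on_wirtinger(2)[OF S(1) G(1)] S(2)]] .
  finally show ?thesis using herm by simp
qed

section \<open>Inverting the Levi matrix\<close>

lemma hermitian_pos_def_invertible:
  assumes "hermitian_pos_def H"
  shows "invertible H"
proof -
  have "x = 0" if "H *v x = 0" for x
  proof (rule ccontr)
    assume "x \<noteq> 0"
    \<comment> \<open>\<open>hermitian_pos_def\<close> pairs the row index with \<open>v\<close> and
      the column index with its conjugate, so the form has to be evaluated at the conjugate of
      \<open>x\<close> for \<open>H *v x\<close> to appear.\<close>
    then have nz: "(\<chi> j. cnj (x $ j)) \<noteq> 0" by (auto simp: vec_eq_iff)
    have pos: "\<And>v. v \<noteq> 0 \<Longrightarrow> 0 < Re (\<Sum>i\<in>UNIV. \<Sum>j\<in>UNIV. H $ i $ j * v $ i * cnj (v $ j))"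
      using assms unfolding hermitian_pos_def_def by blast
    have "0 < Re (\<Sum>i\<in>UNIV. \<Sum>j\<in>UNIV. H $ i $ j * cnj (x $ i) * x $ j)"
      using pos[OF nz] by simp
    also have "(\<Sum>i\<in>UNIV. \<Sum>j\<in>UNIV. H $ i $ j * cnj (x $ i) * x $ j)
        = (\<Sum>i\<in>UNIV. cnj (x $ i) * (H *v x) $ i)"
      by (intro sum.cong refl) (simp add: matrix_vector_mult_def sum_distrib_left mult.left_commute mult.assoc)
    finally show False using that by simp
  qed
  then show ?thesis
    by (metis invertible_left_inverse matrix_left_invertible_ker)
qed

lemma matrix_mult_matrix_inv: "invertible H \<Longrightarrow> H ** matrix_inv H = mat 1"
  unfolding matrix_inv_def invertible_def by (rule someI2_ex) auto

text \<open>By Cramer's rule each entry of the inverse is a quotient of two determinants, which are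
  polynomials in the entries. Invertibility on a whole neighbourhood makes this formula valid near
  \<open>x\<close> and not just at it.\<close>

lemma matrix_inv_differentiable:
  fixes H :: "'a::real_normed_vector \<Rightarrow> complex^'n::finite^'n"
  assumes S: "open S" "x \<in> S" and inv: "\<And>y. y \<in> S \<Longrightarrow> invertible (H y)"
    and diff: "\<And>i j. (\<lambda>y. H y $ i $ j) differentiable at x"
  shows "(\<lambda>y. matrix_inv (H y) $ i $ j) differentiable at x"
proof -
  have det_diff: "(\<lambda>y. det (M y)) differentiable at x"
    if "\<And>i j. (\<lambda>y. M y $ i $ j) differentiable at x" for M :: "'a \<Rightarrow> complex^'n^'n"
  proof -
    have "((\<lambda>y. M y $ i $ j) has_derivative frechet_derivative (\<lambda>y. M y $ i $ j) (at x)) (at x)" for i j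
      using that frechet_derivative_works by blast
    then have "(\<lambda>y. \<Prod>i\<in>UNIV. M y $ i $ p i) differentiable at x" for p
      by (intro differentiableI[OF has_derivative_prod])
    then show ?thesis
      unfolding det_def by (intro differentiable_sum differentiable_mult) auto
  qed
  \<comment> \<open>Column \<open>i\<close> of \<open>H y\<close> replaced by the
    \<open>j\<close>-th unit vector: the numerator of Cramer's rule for
    \<open>H y *v x = axis j 1\<close>.\<close>
  define M where "M y = (\<chi> r s. if s = i then axis j 1 $ r else H y $ r $ s)" for y
  have eq: "det (M y) / det (H y) = matrix_inv (H y) $ i $ j" if "y \<in> S" for y
  proof -
    have "det (H y) \<noteq> 0" using inv[OF that] by (simp add: invertible_det_nz)
    moreover have "H y *v (matrix_inv (H y) *v axis j 1) = axis j 1"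
      by (simp add: matrix_vector_mul_assoc matrix_mult_matrix_inv inv[OF that])
    ultimately have x: "matrix_inv (H y) *v axis j 1
        = (\<chi> k. det (\<chi> r s. if s = k then axis j 1 $ r else H y $ r $ s) / det (H y))"
      by (rule iffD1[OF cramer])
    have "matrix_inv (H y) $ i $ j = (matrix_inv (H y) *v axis j 1) $ i"
      by (simp add: matrix_vector_mult_def axis_def if_distrib cong: if_cong)
    then show ?thesis unfolding x M_def by simp
  qed
  have "(\<lambda>y. M y $ r $ s) differentiable at x" for r s
  proof (cases "s = i")
    case True
    then show ?thesis by (simp add: M_def)
  next
    case False
    then have "(\<lambda>y. M y $ r $ s) = (\<lambda>y. H y $ r $ s)" by (simp add: M_def)
    with diff[of r s] show ?thesis by simp
  qed
  then have "(\<lambda>y. det (M y) / det (H y)) differentiable at x"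
    using det_diff[of M] det_diff[OF diff] inv[OF S(2)]
    by (intro differentiable_divide) (auto simp: invertible_det_nz)
  then obtain D where "((\<lambda>y. det (M y) / det (H y)) has_derivative D) (at x)"
    unfolding differentiable_def by blast
  from has_derivative_transform_within_open[OF this S eq] show ?thesis
    by (rule differentiableI)
qed

section \<open>Wirtinger derivatives of expressions linear along a fiber\<close>

lemma scaleR_eq_smult: "r *\<^sub>R v = complex_of_real r *s v"
  by (simp add: vec_eq_iff scaleR_conv_of_real[where 'a = complex])

text \<open>The left-hand side, \<open>P u\<close> in the proof, is twice the complex linear part of
  the real linear map \<open>D\<close>, and a complex linear map is determined by its values on the
  unit vectors.\<close>

lemma wirtinger_sum:
  fixes D :: "(complex^'n::finite) \<Rightarrow> complex"
  assumes "linear D"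
  shows "D u - \<i> * D (\<i> *s u) = (\<Sum>i\<in>UNIV. u $ i * (D (axis i 1) - \<i> * D (axis i \<i>)))"
proof -
  interpret linear D by fact
  define P where "P u = D u - \<i> * D (\<i> *s u)" for u
  have add: "P (u + v) = P u + P v" for u v
    by (simp add: P_def add vector_add_ldistrib algebra_simps)
  have ii: "\<i> *s (\<i> *s v) = - v" for v :: "complex^'n"
    by (simp add: vec_eq_iff)
  have Pr: "P (of_real r *s v) = of_real r * P v" for r v
  proof -
    have "\<i> *s (of_real r *s v) = r *\<^sub>R (\<i> *s v)"
      by (simp add: vec_eq_iff scaleR_conv_of_real[where 'a = complex])
    then show ?thesis
      by (simp add: P_def scaleR_eq_smult[symmetric] scale scaleR_conv_of_real[where 'a = complex] algebra_simps)
  qed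
  have Pi: "P (\<i> *s v) = \<i> * P v" for v
    by (simp add: P_def ii neg algebra_simps)
  have scale: "P (a *s v) = a * P v" for a v
  proof -
    have "a *s v = of_real (Re a) *s v + of_real (Im a) *s (\<i> *s v)"
      by (subst complex_eq[of a]) (simp add: vec_eq_iff algebra_simps)
    then have "P (a *s v) = (of_real (Re a) + \<i> * of_real (Im a)) * P v"
      by (simp only: add Pr Pi) (simp add: algebra_simps)
    then show ?thesis using complex_eq[of a] by simp
  qed
  have "P (\<Sum>i\<in>T. u $ i *s axis i 1) = (\<Sum>i\<in>T. u $ i * P (axis i 1))" if "finite T" for T
    using that
  proof induction
    case empty
    show ?case using scale[of 0 0] by simp
  qed (simp add: add scale)
  from this[of UNIV] have "P u = (\<Sum>i\<in>UNIV. u $ i * P (axis i 1))"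
    by (simp add: basis_expansion)
  moreover have "\<i> *s axis i 1 = (axis i \<i> :: complex^'n)" for i
    by (simp add: vec_eq_iff axis_def)
  ultimately show ?thesis by (simp add: P_def)
qed

text \<open>The formula is assumed on one fiber only, so the differentiability of \<open>f\<close>
  in all variables is a separate hypothesis.\<close>

lemma d_w_of_holomorphic_linear:
  fixes f :: "(complex^'n::finite) \<times> (complex^'n) \<Rightarrow> complex"
  assumes f: "f differentiable at (z, w)" and w: "w \<noteq> 0"
    and eq: "\<And>w. w \<noteq> 0 \<Longrightarrow> f (z, w) = - (C *v w) $ i"
  shows "d_w j f (z, w) = - C $ i $ j"
proof -
  have "bounded_linear (\<lambda>w. - (C *v w) $ i)"
    unfolding linear_conv_bounded_linear[symmetric]
    by (simp add: linear_iff matrix_vector_right_distrib scaleR_eq_smult vector_scalar_commute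
        scaleR_conv_of_real[where 'a = complex])
  then have "((\<lambda>w. - (C *v w) $ i) has_derivative (\<lambda>w. - (C *v w) $ i)) (at w)"
    by (rule bounded_linear_imp_has_derivative)
  then have "((\<lambda>w. f (z, w)) has_derivative (\<lambda>w. - (C *v w) $ i)) (at w)"
    by (rule has_derivative_transform_within_open[where s = "- {0}"]) (use w eq in auto)
  then have "frechet_derivative f (at (z, w)) (0, v) = - (C *v v) $ i" for v
    by (rule frechet_derivative_slice[OF f])
  then show ?thesis
    by (simp add: d_w_def matrix_vector_mult_def axis_def if_distrib cong: if_cong)
      (simp add: complex_eq_iff)
qed

text \<open>This is the product rule with the coefficients \<open>(C *v w) $ i\<close> holomorphic
  in \<open>w\<close>: they pass through \<open>d_wbar\<close> like constants.\<close>

lemma d_wbar_of_linear_combination: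
  fixes f :: "(complex^'n::finite) \<times> (complex^'n) \<Rightarrow> complex"
  assumes f: "f differentiable at (z, w)" and w: "w \<noteq> 0"
    and g: "\<And>i. g i differentiable at (z, w)"
    and eq: "\<And>w. w \<noteq> 0 \<Longrightarrow> f (z, w) = - (\<Sum>i\<in>UNIV. (C *v w) $ i * g i (z, w))"
  shows "d_wbar j f (z, w) = - (\<Sum>i\<in>UNIV. (C *v w) $ i * d_wbar j (g i) (z, w))"
proof -
  have "bounded_linear (\<lambda>w. (C *v w) $ i)" for i
    unfolding linear_conv_bounded_linear[symmetric]
    by (simp add: linear_iff matrix_vector_right_distrib scaleR_eq_smult vector_scalar_commute
        scaleR_conv_of_real[where 'a = complex])
  then have C: "((\<lambda>w. (C *v w) $ i) has_derivative (\<lambda>w. (C *v w) $ i)) (at w)" for i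
    by (rule bounded_linear_imp_has_derivative)
  have p: "((\<lambda>w. (z, w)) has_derivative (\<lambda>v. (0, v))) (at w)"
    by (auto intro!: derivative_eq_intros)
  have g': "((\<lambda>w. g i (z, w)) has_derivative (\<lambda>v. frechet_derivative (g i) (at (z, w)) (0, v))) (at w)" for i
    by (rule has_derivative_compose[OF p]) (use g in \<open>simp add: frechet_derivative_works[symmetric]\<close>)
  have "((\<lambda>w. - (\<Sum>i\<in>UNIV. (C *v w) $ i * g i (z, w))) has_derivative
      (\<lambda>v. - (\<Sum>i\<in>UNIV. (C *v w) $ i * frechet_derivative (g i) (at (z, w)) (0, v)
          + (C *v v) $ i * g i (z, w)))) (at w)"
    by (intro has_derivative_minus has_derivative_sum has_derivative_mult C g')
  then have "((\<lambda>w. f (z, w)) has_derivative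
      (\<lambda>v. - (\<Sum>i\<in>UNIV. (C *v w) $ i * frechet_derivative (g i) (at (z, w)) (0, v)
          + (C *v v) $ i * g i (z, w)))) (at w)"
    by (rule has_derivative_transform_within_open[where s = "- {0}"]) (use w eq in auto)
  then have D: "frechet_derivative f (at (z, w)) (0, v) =
      - (\<Sum>i\<in>UNIV. (C *v w) $ i * frechet_derivative (g i) (at (z, w)) (0, v)
          + (C *v v) $ i * g i (z, w))" for v
    by (rule frechet_derivative_slice[OF f])
  have ax: "(C *v axis j a) $ i = C $ i $ j * a" for i a
    by (simp add: matrix_vector_mult_def axis_def if_distrib cong: if_cong)
  define a b where "a i = frechet_derivative (g i) (at (z, w)) (0, axis j 1)"
    and "b i = frechet_derivative (g i) (at (z, w)) (0, axis j \<i>)" for i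
  have g2: "2 * d_wbar j (g i) (z, w) = a i + \<i> * b i" for i
    by (simp add: d_wbar_def a_def b_def)
  \<comment> \<open>Up to sign, the derivatives of the sum in the two real directions of
    \<open>d_wbar\<close>. In \<open>P + i Q\<close> the terms with \<open>C $ i $ j\<close> cancel,
    because the square of the imaginary unit is -1.\<close>
  define P Q where "P i = (C *v w) $ i * a i + C $ i $ j * g i (z, w)"
    and "Q i = (C *v w) $ i * b i + C $ i $ j * \<i> * g i (z, w)" for i
  have "2 * d_wbar j f (z, w) = - (\<Sum>i\<in>UNIV. P i) + \<i> * - (\<Sum>i\<in>UNIV. Q i)"
    by (simp add: d_wbar_def D ax a_def b_def P_def Q_def)
  also have "\<dots> = (\<Sum>i\<in>UNIV. - P i + \<i> * - Q i)"
    by (simp only: sum_negf[symmetric] sum_distrib_left sum.distrib[symmetric])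
  also have "\<dots> = (\<Sum>i\<in>UNIV. - ((C *v w) $ i * (2 * d_wbar j (g i) (z, w))))"
    unfolding g2 P_def Q_def using i_squared by (intro sum.cong refl) algebra
  also have "\<dots> = 2 * - (\<Sum>i\<in>UNIV. (C *v w) $ i * d_wbar j (g i) (z, w))"
    by (simp add: sum_distrib_left sum_negf algebra_simps)
  finally show ?thesis by simp
qed

section \<open>Maps in local coordinates\<close>

lemma is_chartD:
  assumes "is_chart X c"
  shows "openin X (fst c)" and "open (chart_image c)" and "inj_on (snd c) (fst c)"
    and "continuous_map (subtopology X (fst c)) euclidean (snd c)"
    and "openin X U \<Longrightarrow> open (snd c ` (fst c \<inter> U))"
proof -
  have h: "homeomorphic_map (subtopology X (fst c)) (top_of_set (chart_image c)) (snd c)"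
    and o: "openin X (fst c)" "open (chart_image c)"
    using assms by (auto simp: is_chart_def)
  show "openin X (fst c)" "open (chart_image c)" by (rule o)+
  have "topspace (subtopology X (fst c)) = fst c"
    using openin_subset[OF o(1)] by auto
  then show "inj_on (snd c) (fst c)"
    using homeomorphic_imp_injective_map[OF h] by simp
  show "continuous_map (subtopology X (fst c)) euclidean (snd c)"
    using homeomorphic_imp_continuous_map[OF h] continuous_map_into_fulltopology by blast
  show "open (snd c ` (fst c \<inter> U))" if "openin X U"
  proof -
    have "openin (subtopology X (fst c)) (fst c \<inter> U)"
      using that by (auto simp: openin_subtopology)
    then have "openin (top_of_set (chart_image c)) (snd c ` (fst c \<inter> U))"
      using homeomorphic_imp_open_map[OF h] by (auto simp: open_map_def)
    then show ?thesis using o(2) openin_open_trans by blast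
  qed
qed

lemma chart_inv_apply: "is_chart X c \<Longrightarrow> p \<in> fst c \<Longrightarrow> chart_inv c (snd c p) = p"
  by (simp add: chart_inv_def is_chartD(3))

lemma chart_apply_inv: "z \<in> chart_image c \<Longrightarrow> snd c (chart_inv c z) = z"
  by (simp add: chart_inv_def chart_image_def f_inv_into_f)

lemma chart_inv_in: "z \<in> chart_image c \<Longrightarrow> chart_inv c z \<in> fst c"
  by (simp add: chart_inv_def chart_image_def inv_into_into)

lemma chart_apply_in: "p \<in> fst c \<Longrightarrow> snd c p \<in> chart_image c"
  by (simp add: chart_image_def)

lemma chart_inv_continuous:
  assumes "is_chart X c"
  shows "continuous_map (top_of_set (chart_image c)) X (chart_inv c)"
  unfolding continuous_map_def
proof (intro conjI allI impI)
  show "chart_inv c \<in> topspace (top_of_set (chart_image c)) \<rightarrow> topspace X"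
    using chart_inv_in openin_subset[OF is_chartD(1)[OF assms]] by fastforce
  fix U assume "openin X U"
  have "{z \<in> topspace (top_of_set (chart_image c)). chart_inv c z \<in> U} = snd c ` (fst c \<inter> U)"
  proof (intro equalityI subsetI)
    fix z assume "z \<in> {z \<in> topspace (top_of_set (chart_image c)). chart_inv c z \<in> U}"
    then have z: "z \<in> chart_image c" "chart_inv c z \<in> U" by auto
    then show "z \<in> snd c ` (fst c \<inter> U)"
      using chart_inv_in[OF z(1)] chart_apply_inv[OF z(1)] by (intro image_eqI[where x = "chart_inv c z"]) auto
  next
    fix z assume "z \<in> snd c ` (fst c \<inter> U)"
    then obtain p where p: "p \<in> fst c" "p \<in> U" "z = snd c p" by blast
    then show "z \<in> {z \<in> topspace (top_of_set (chart_image c)). chart_inv c z \<in> U}"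
      using chart_inv_apply[OF assms p(1)] chart_apply_in[OF p(1)] by simp
  qed
  moreover have "snd c ` (fst c \<inter> U) \<subseteq> chart_image c"
    by (auto simp: chart_image_def)
  ultimately show "openin (top_of_set (chart_image c)) {z \<in> topspace (top_of_set (chart_image c)). chart_inv c z \<in> U}"
    using is_chartD(2)[OF assms] is_chartD(5)[OF assms \<open>openin X U\<close>]
    by (simp only: openin_open_eq)
qed

text \<open>With \<open>f = id\<close> this is \<open>transition\<close>, so a single chain rule
  covers maps and coordinate changes on either side.\<close>

definition local_rep :: "('a \<Rightarrow> 'b) \<Rightarrow> ('a, 'm::finite) chart \<Rightarrow> ('b, 'n::finite) chart \<Rightarrow> complex^'m \<Rightarrow> complex^'n"
  where "local_rep f c d = snd d \<circ> f \<circ> chart_inv c"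

lemma transition_eq_local_rep: "transition c d = local_rep id c d"
  by (simp add: transition_def local_rep_def)

lemma local_rep_compose:
  assumes c: "is_chart X c" and d: "is_chart X d" and p: "p \<in> fst c" "f p \<in> fst d"
    and f: "continuous_map X X f"
    and df: "complex_diff_at (local_rep f c d) (snd c p)"
    and dg: "complex_diff_at (local_rep g d e) (snd d (f p))"
  shows "complex_diff_at (local_rep (g \<circ> f) c e) (snd c p)"
    and "frechet_derivative (local_rep (g \<circ> f) c e) (at (snd c p)) v =
      frechet_derivative (local_rep g d e) (at (snd d (f p)))
        (frechet_derivative (local_rep f c d) (at (snd c p)) v)"
proof -
  \<comment> \<open>The middle chart cancels exactly where \<open>f\<close> takes values in its
    domain; continuity of \<open>f\<close> makes this set open.\<close>
  define S where "S = snd c ` (fst c \<inter> {x \<in> topspace X. f x \<in> fst d})"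
  have "open S"
    unfolding S_def
    using openin_continuous_map_preimage[OF f] is_chartD(1)[OF d] by (intro is_chartD(5)[OF c]) blast
  moreover have "snd c p \<in> S"
    using p openin_subset[OF is_chartD(1)[OF c]] by (auto simp: S_def)
  moreover have "(local_rep g d e \<circ> local_rep f c d) x = local_rep (g \<circ> f) c e x" if "x \<in> S" for x
    using that chart_inv_apply[OF c] chart_inv_apply[OF d] by (auto simp: S_def local_rep_def)
  moreover have v: "local_rep f c d (snd c p) = snd d (f p)"
    using p chart_inv_apply[OF c] by (simp add: local_rep_def)
  ultimately have S: "open S" "snd c p \<in> S"
      "\<And>x. x \<in> S \<Longrightarrow> (local_rep g d e \<circ> local_rep f c d) x = local_rep (g \<circ> f) c e x"
    and dg': "complex_diff_at (local_rep g d e) (local_rep f c d (snd c p))"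
    using dg by auto
  note comp = complex_diff_at_compose[OF df dg']
  show "complex_diff_at (local_rep (g \<circ> f) c e) (snd c p)"
    using complex_diff_at_transform(1)[OF comp(1) S] .
  show "frechet_derivative (local_rep (g \<circ> f) c e) (at (snd c p)) v =
      frechet_derivative (local_rep g d e) (at (snd d (f p)))
        (frechet_derivative (local_rep f c d) (at (snd c p)) v)"
    by (simp only: complex_diff_at_transform(2)[OF comp(1) S] comp(2) v)
qed

section \<open>Independence of the chart throughout the maximal atlas\<close>

locale complex_manifold_locale =
  fixes X :: "'a topology" and A :: "('a, 'n::finite) chart set"
  assumes manifold: "complex_manifold X A"
begin

lemma holomorphic_charts_is_chart: "c \<in> holomorphic_charts X A \<Longrightarrow> is_chart X c"
  by (simp add: holomorphic_charts_def)

lemma atlas_subset: "c \<in> A \<Longrightarrow> c \<in> holomorphic_charts X A"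
  using manifold by (simp add: holomorphic_charts_def complex_manifold_def)

lemma chart_domain_subset: "c \<in> holomorphic_charts X A \<Longrightarrow> fst c \<subseteq> topspace X"
  using is_chartD(1) holomorphic_charts_is_chart openin_subset by blast

lemma ex_atlas_chart: "p \<in> topspace X \<Longrightarrow> \<exists>c\<in>A. p \<in> fst c"
  using manifold by (auto simp: complex_manifold_def)

text \<open>Charts of the maximal atlas are by definition compatible with members of
  \<open>A\<close> only. Two of them are compared through a chart of \<open>A\<close> around
  \<open>p\<close>.\<close>

lemma transition_complex_diff:
  assumes c: "c \<in> holomorphic_charts X A" and d: "d \<in> holomorphic_charts X A"
    and p: "p \<in> fst c" "p \<in> fst d"
  shows "complex_diff_at (transition c d) (snd c p)"
proof -
  have "p \<in> topspace X" using chart_domain_subset[OF c] p by blast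
  then obtain e where e: "e \<in> A" "p \<in> fst e"
    using ex_atlas_chart by blast
  have "compatible c e" "compatible d e"
    using c d e by (simp_all add: holomorphic_charts_def)
  then have "complex_diff_at (transition c e) (snd c p)" "complex_diff_at (transition e d) (snd e p)"
    using p e by (auto simp: compatible_def intro!: vec_holomorphic_onD)
  then show ?thesis
    using local_rep_compose(1)[where f = id and g = id and X = X and d = e and e = d and c = c and p = p]
      holomorphic_charts_is_chart[OF c] holomorphic_charts_is_chart[OF atlas_subset[OF e(1)]] p e
    by (simp add: transition_eq_local_rep continuous_map_id)
qed

lemma local_rep_change_source:
  assumes c: "c \<in> holomorphic_charts X A" and c': "c' \<in> holomorphic_charts X A"
    and p: "p \<in> fst c" "p \<in> fst c'"
    and d: "complex_diff_at (local_rep f c' e) (snd c' p)"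
  shows "complex_diff_at (local_rep f c e) (snd c p)"
    and "frechet_derivative (local_rep f c e) (at (snd c p)) v =
      frechet_derivative (local_rep f c' e) (at (snd c' p))
        (frechet_derivative (transition c c') (at (snd c p)) v)"
proof -
  have "complex_diff_at (local_rep id c c') (snd c p)"
    using transition_complex_diff[OF c c' p] by (simp only: transition_eq_local_rep)
  moreover have "id p \<in> fst c'" "complex_diff_at (local_rep f c' e) (snd c' (id p))"
    using p d by simp_all
  ultimately have
      "complex_diff_at (local_rep (f \<circ> id) c e) (snd c p)"
      "frechet_derivative (local_rep (f \<circ> id) c e) (at (snd c p)) v =
        frechet_derivative (local_rep f c' e) (at (snd c' (id p)))
          (frechet_derivative (local_rep id c c') (at (snd c p)) v)"
    using local_rep_compose[OF holomorphic_charts_is_chart[OF c] holomorphic_charts_is_chart[OF c'] p(1) _ continuous_map_id]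
    by blast+
  then show "complex_diff_at (local_rep f c e) (snd c p)"
    and "frechet_derivative (local_rep f c e) (at (snd c p)) v =
      frechet_derivative (local_rep f c' e) (at (snd c' p))
        (frechet_derivative (transition c c') (at (snd c p)) v)"
    by (simp_all only: transition_eq_local_rep comp_id id_apply)
qed

lemma local_rep_change_target:
  assumes f: "continuous_map X X f"
    and c: "c \<in> holomorphic_charts X A" and e: "e \<in> holomorphic_charts X A"
    and e': "e' \<in> holomorphic_charts X A"
    and p: "p \<in> fst c" "f p \<in> fst e" "f p \<in> fst e'"
    and d: "complex_diff_at (local_rep f c e) (snd c p)"
  shows "complex_diff_at (local_rep f c e') (snd c p)"
    and "frechet_derivative (local_rep f c e') (at (snd c p)) v =
      frechet_derivative (transition e e') (at (snd e (f p)))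
        (frechet_derivative (local_rep f c e) (at (snd c p)) v)"
proof -
  have "complex_diff_at (local_rep id e e') (snd e (f p))"
    using transition_complex_diff[OF e e' p(2,3)] by (simp only: transition_eq_local_rep)
  note r = local_rep_compose[OF holomorphic_charts_is_chart[OF c] holomorphic_charts_is_chart[OF e] p(1,2) f d this]
  show "complex_diff_at (local_rep f c e') (snd c p)"
    using r(1) by (simp only: id_comp)
  show "frechet_derivative (local_rep f c e') (at (snd c p)) v =
      frechet_derivative (transition e e') (at (snd e (f p)))
        (frechet_derivative (local_rep f c e) (at (snd c p)) v)"
    using r(2) by (simp only: transition_eq_local_rep id_comp)
qed

text \<open>The group axioms speak of the atlas \<open>A\<close>, whereas the Berwald condition
  ranges over all holomorphic charts; changing source and target charts bridges the gap.\<close>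

lemma holomorphic_in_all_charts:
  assumes f: "continuous_map X X f"
    and df: "\<And>c e p. c \<in> A \<Longrightarrow> e \<in> A \<Longrightarrow> p \<in> fst c \<Longrightarrow> f p \<in> fst e \<Longrightarrow>
      complex_diff_at (local_rep f c e) (snd c p)"
    and c: "c \<in> holomorphic_charts X A" and e: "e \<in> holomorphic_charts X A"
    and p: "p \<in> fst c" "f p \<in> fst e"
  shows "complex_diff_at (local_rep f c e) (snd c p)"
proof -
  have "p \<in> topspace X" "f p \<in> topspace X"
    using chart_domain_subset[OF c] chart_domain_subset[OF e] p by blast+
  then obtain c0 e0 where c0: "c0 \<in> A" "p \<in> fst c0" and e0: "e0 \<in> A" "f p \<in> fst e0"
    using ex_atlas_chart by metis
  have "complex_diff_at (local_rep f c0 e) (snd c0 p)"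
    using local_rep_change_target(1)[OF f atlas_subset[OF c0(1)] atlas_subset[OF e0(1)] e
        c0(2) e0(2) p(2) df[OF c0(1) e0(1) c0(2) e0(2)]] .
  then show ?thesis
    by (rule local_rep_change_source(1)[OF c atlas_subset[OF c0(1)] p(1) c0(2)])
qed

text \<open>The transformation law of the components is the chain rule for coordinate changes.
  Membership matters since \<open>left_invariant\<close> quantifies over \<open>T10\<close>
  only.\<close>

lemma tvec_of_coords_in_T10:
  assumes c: "c \<in> holomorphic_charts X A" and z: "z \<in> chart_image c"
  shows "tvec_of_coords X A c (z, w) \<in> T10 X A"
proof -
  define p where "p = chart_inv c z"
  have p: "p \<in> fst c" "snd c p = z"
    using chart_inv_in[OF z] chart_apply_inv[OF z] by (auto simp: p_def)
  define v where "v d = (if d \<in> charts_at X A p then frechet_derivative (transition c d) (at z) w else 0)" for d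
  have "v \<in> tangent_space X A p"
    unfolding tangent_space_def
  proof (rule CollectI, intro conjI ballI allI impI)
    fix c' d' assume cd': "c' \<in> charts_at X A p" "d' \<in> charts_at X A p"
    then have cd: "c' \<in> holomorphic_charts X A" "p \<in> fst c'" "d' \<in> holomorphic_charts X A" "p \<in> fst d'"
      by (simp_all add: charts_at_def)
    show "v d' = frechet_derivative (transition c' d') (at (snd c' p)) (v c')"
      using local_rep_change_source(2)[OF c cd(1) p(1) cd(2), of id d'] transition_complex_diff[OF cd(1,3,2,4)] p(2) cd'
      by (simp add: transition_eq_local_rep v_def)
  next
    fix c' assume "c' \<notin> charts_at X A p"
    then show "v c' = 0" by (simp add: v_def)
  qed
  moreover have "p \<in> topspace X" using p chart_domain_subset[OF c] by blast
  moreover have "tvec_of_coords X A c (z, w) = (p, v)"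
    by (simp add: tvec_of_coords_def p_def v_def[abs_def])
  ultimately show ?thesis
    by (simp add: T10_def)
qed

text \<open>\<open>pushforward\<close> computes in an auxiliary chart \<open>c'\<close> picked by
  choice. The chain rule replaces \<open>c'\<close> by \<open>c\<close> at the source and routes
  every target chart \<open>d\<close> through \<open>e\<close>, which identifies the
  components.\<close>

lemma pushforward_tvec_of_coords:
  assumes f: "continuous_map X X f"
    and df: "\<And>c e p. c \<in> holomorphic_charts X A \<Longrightarrow> e \<in> holomorphic_charts X A \<Longrightarrow>
      p \<in> fst c \<Longrightarrow> f p \<in> fst e \<Longrightarrow> complex_diff_at (local_rep f c e) (snd c p)"
    and c: "c \<in> holomorphic_charts X A" and e: "e \<in> holomorphic_charts X A"
    and z: "z \<in> chart_image c" and fe: "f (chart_inv c z) \<in> fst e"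
  shows "pushforward X A X A f (tvec_of_coords X A c (z, w)) =
    tvec_of_coords X A e (snd e (f (chart_inv c z)), frechet_derivative (local_rep f c e) (at z) w)"
proof -
  define p where "p = chart_inv c z"
  have p: "p \<in> fst c" "snd c p = z"
    using chart_inv_in[OF z] chart_apply_inv[OF z] by (auto simp: p_def)
  have fp: "f p \<in> fst e" using fe by (simp add: p_def)
  define c' where "c' = (SOME c. c \<in> charts_at X A p)"
  have "c \<in> charts_at X A p" using c p by (simp add: charts_at_def)
  then have "c' \<in> charts_at X A p" unfolding c'_def by (rule someI)
  then have c': "c' \<in> holomorphic_charts X A" "p \<in> fst c'" by (auto simp: charts_at_def)
  have inv: "chart_inv e (snd e (f p)) = f p"
    using chart_inv_apply[OF holomorphic_charts_is_chart[OF e] fp] .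
  have "frechet_derivative (local_rep f c' d) (at (snd c' p)) (frechet_derivative (transition c c') (at z) w)
      = frechet_derivative (transition e d) (at (snd e (f p))) (frechet_derivative (local_rep f c e) (at z) w)"
    if "d \<in> charts_at X A (f p)" for d
  proof -
    have d: "d \<in> holomorphic_charts X A" "f p \<in> fst d" using that by (auto simp: charts_at_def)
    note local_rep_change_source(2)[OF c c'(1) p(1) c'(2) df[OF c'(1) d(1) c'(2) d(2)], of w]
    moreover note local_rep_change_target(2)[OF f c e d(1) p(1) fp d(2) df[OF c e p(1) fp], of w]
    ultimately show ?thesis by (simp add: p)
  qed
  then have "(\<lambda>d. if d \<in> charts_at X A (f p) then frechet_derivative (local_rep f c' d) (at (snd c' p))
        (frechet_derivative (transition c c') (at z) w) else 0)
    = (\<lambda>d. if d \<in> charts_at X A (f p) then frechet_derivative (transition e d) (at (snd e (f p)))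
        (frechet_derivative (local_rep f c e) (at z) w) else 0)" by auto
  then show ?thesis
    using \<open>c' \<in> charts_at X A p\<close>
    by (simp add: pushforward_def tvec_of_coords_def p_def[symmetric] inv Let_def c'_def[symmetric]
        local_rep_def[symmetric] cong: if_cong)
qed

end

section \<open>Translations of a complex Lie group\<close>

text \<open>The coordinates of \<open>prod_chart\<close> as a function of two vectors. It is affine
  in each argument, so freezing one factor of the group multiplication preserves complex
  differentiability.\<close>

definition stack :: "complex^'m::finite \<Rightarrow> complex^'n::finite \<Rightarrow> complex^('m + 'n)"
  where "stack x y = (\<chi> k. case k of Inl i \<Rightarrow> x $ i | Inr j \<Rightarrow> y $ j)"

lemma snd_prod_chart: "snd (prod_chart c d) (p, q) = stack (snd c p) (snd d q)"
  by (simp add: prod_chart_def stack_def)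

lemma stack_eq_iff: "stack x y = stack x' y' \<longleftrightarrow> x = x' \<and> y = y'"
proof
  assume "stack x y = stack x' y'"
  then have "stack x y $ Inl i = stack x' y' $ Inl i" "stack x y $ Inr j = stack x' y' $ Inr j" for i j
    by auto
  then show "x = x' \<and> y = y'" by (simp add: stack_def vec_eq_iff)
qed auto

lemma chart_inv_prod_chart:
  assumes c: "is_chart X c" and d: "is_chart Y d" and p: "p \<in> fst c" and q: "q \<in> fst d"
  shows "chart_inv (prod_chart c d) (stack (snd c p) (snd d q)) = (p, q)"
proof -
  have "inj_on (snd (prod_chart c d)) (fst (prod_chart c d))"
    using is_chartD(3)[OF c] is_chartD(3)[OF d]
    by (auto intro!: inj_onI simp: snd_prod_chart stack_eq_iff dest: inj_onD)
       (auto simp: prod_chart_def dest: inj_onD)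
  moreover have "(p, q) \<in> fst (prod_chart c d)" using p q by (simp add: prod_chart_def)
  ultimately have "chart_inv (prod_chart c d) (snd (prod_chart c d) (p, q)) = (p, q)"
    unfolding chart_inv_def by (rule inv_into_f_f)
  then show ?thesis by (simp add: snd_prod_chart)
qed

lemma complex_diff_at_affine:
  assumes "\<And>x y. f (x + y) = f x + f y" "\<And>a x. f (a *s x) = a *s f x" "\<And>x. g x = b + f x"
  shows "complex_diff_at g z"
proof -
  have "linear f" using assms(1,2) by (simp add: linear_iff scaleR_eq_smult)
  then have "(f has_derivative f) (at z)"
    by (simp add: linear_conv_bounded_linear bounded_linear_imp_has_derivative)
  then have "((\<lambda>x. b + f x) has_derivative f) (at z)"
    using has_derivative_add[OF has_derivative_const[of b], of f f "at z"] by simp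
  moreover have "g = (\<lambda>x. b + f x)" using assms(3) by blast
  ultimately show ?thesis unfolding complex_diff_at_def using assms(2) by blast
qed

lemma complex_diff_at_stack: "complex_diff_at (stack x) y" "complex_diff_at (\<lambda>x. stack x y) x"
  by (rule complex_diff_at_affine[where f = "stack 0" and b = "stack x 0"];
      auto simp: stack_def vec_eq_iff split: sum.split)
     (rule complex_diff_at_affine[where f = "\<lambda>x. stack x 0" and b = "stack 0 y"];
      auto simp: stack_def vec_eq_iff split: sum.split)

locale complex_Lie_group_locale =
  fixes G :: "('a, 'b) monoid_scheme" (structure)
    and X :: "'a topology"
    and A :: "('a, 'n::finite) chart set"
  assumes Lie: "complex_Lie_group G X A"

sublocale complex_Lie_group_locale \<subseteq> group G
  by (use Lie in \<open>simp add: complex_Lie_group_def\<close>)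

sublocale complex_Lie_group_locale \<subseteq> complex_manifold_locale X A
  by unfold_locales (use Lie in \<open>simp add: complex_Lie_group_def\<close>)

context complex_Lie_group_locale
begin

lemma topspace_eq: "topspace X = carrier G"
  using Lie by (simp add: complex_Lie_group_def)

lemma mult_continuous:
  assumes "continuous_map Y X f" "continuous_map Y X g"
  shows "continuous_map Y X (\<lambda>y. f y \<otimes> g y)"
proof -
  have "continuous_map (prod_topology X X) X (\<lambda>(x, y). x \<otimes> y)"
    using Lie by (simp add: complex_Lie_group_def holomorphic_map_def)
  moreover have "continuous_map Y (prod_topology X X) (\<lambda>y. (f y, g y))"
    using assms by (simp add: continuous_map_pairedI)
  ultimately have "continuous_map Y X ((\<lambda>(x, y). x \<otimes> y) \<circ> (\<lambda>y. (f y, g y)))"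
    by (rule continuous_map_compose[rotated])
  then show ?thesis by (simp add: o_def)
qed

lemma translation_continuous:
  assumes "g \<in> carrier G"
  shows "continuous_map X X (\<lambda>h. g \<otimes> h)" "continuous_map X X (\<lambda>h. h \<otimes> g)"
proof -
  have "continuous_map X X (\<lambda>h. g)"
    using assms topspace_eq by (simp only: continuous_map_const simp_thms)
  moreover have "continuous_map X X (\<lambda>h. h)"
    by (rule continuous_map_id[unfolded id_def])
  ultimately show "continuous_map X X (\<lambda>h. g \<otimes> h)" and "continuous_map X X (\<lambda>h. h \<otimes> g)"
    using mult_continuous[of X "\<lambda>h. g" "\<lambda>h. h"] mult_continuous[of X "\<lambda>h. h" "\<lambda>h. g"] by simp_all
qed

lemma mult_complex_diff:
  assumes "c \<in> A" "d \<in> A" "e \<in> A" "p \<in> fst c" "q \<in> fst d" "p \<otimes> q \<in> fst e"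
  shows "complex_diff_at (snd e \<circ> (\<lambda>(x, y). x \<otimes> y) \<circ> chart_inv (prod_chart c d))
    (stack (snd c p) (snd d q))"
proof -
  have "vec_holomorphic_on (snd e \<circ> (\<lambda>(x, y). x \<otimes> y) \<circ> chart_inv (prod_chart c d))
     (snd (prod_chart c d) ` (fst (prod_chart c d) \<inter> (\<lambda>(x, y). x \<otimes> y) -` fst e))"
    using Lie assms unfolding complex_Lie_group_def holomorphic_map_def prod_atlas_def by blast
  moreover have "stack (snd c p) (snd d q)
      \<in> snd (prod_chart c d) ` (fst (prod_chart c d) \<inter> (\<lambda>(x, y). x \<otimes> y) -` fst e)"
    using assms by (intro image_eqI[of _ _ "(p, q)"]) (auto simp: snd_prod_chart, auto simp: prod_chart_def)
  ultimately show ?thesis by (rule vec_holomorphic_onD)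
qed

lemma left_translation_complex_diff:
  assumes g: "g \<in> carrier G" and c: "c \<in> holomorphic_charts X A" and e: "e \<in> holomorphic_charts X A"
    and p: "p \<in> fst c" "g \<otimes> p \<in> fst e"
  shows "complex_diff_at (local_rep (\<lambda>h. g \<otimes> h) c e) (snd c p)"
proof (rule holomorphic_in_all_charts[OF translation_continuous(1)[OF g] _ c e p])
  fix c e p assume c: "c \<in> A" and e: "e \<in> A" and p: "p \<in> fst c" "g \<otimes> p \<in> fst e"
  obtain d where d: "d \<in> A" "g \<in> fst d"
    using ex_atlas_chart g topspace_eq by blast
  note ch = atlas_subset[THEN holomorphic_charts_is_chart]
  show "complex_diff_at (local_rep (\<lambda>h. g \<otimes> h) c e) (snd c p)"
  proof (rule complex_diff_at_transform(1))
    show "complex_diff_at ((snd e \<circ> (\<lambda>(x, y). x \<otimes> y) \<circ> chart_inv (prod_chart d c)) \<circ> stack (snd d g)) (snd c p)"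
      using mult_complex_diff[OF d(1) c e d(2) p] by (rule complex_diff_at_compose(1)[OF complex_diff_at_stack(1)])
    show "open (chart_image c)" "snd c p \<in> chart_image c"
      by (rule is_chartD(2)[OF ch[OF c]], rule chart_apply_in[OF p(1)])
    fix x assume x: "x \<in> chart_image c"
    show "((snd e \<circ> (\<lambda>(x, y). x \<otimes> y) \<circ> chart_inv (prod_chart d c)) \<circ> stack (snd d g)) x = local_rep (\<lambda>h. g \<otimes> h) c e x"
      using chart_inv_prod_chart[OF ch[OF d(1)] ch[OF c] d(2) chart_inv_in[OF x]]
      by (simp add: chart_apply_inv[OF x] local_rep_def)
  qed
qed

text \<open>Although only left translations preserve the metric, right translations control how they
  depend on a parameter: \<open>z \<mapsto> p z \<otimes> h\<close> with \<open>h\<close> fixed is a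
  right translation in the chart.\<close>

lemma right_translation_complex_diff:
  assumes g: "g \<in> carrier G" and c: "c \<in> holomorphic_charts X A" and e: "e \<in> holomorphic_charts X A"
    and p: "p \<in> fst c" "p \<otimes> g \<in> fst e"
  shows "complex_diff_at (local_rep (\<lambda>h. h \<otimes> g) c e) (snd c p)"
proof (rule holomorphic_in_all_charts[OF translation_continuous(2)[OF g] _ c e p])
  fix c e p assume c: "c \<in> A" and e: "e \<in> A" and p: "p \<in> fst c" "p \<otimes> g \<in> fst e"
  obtain d where d: "d \<in> A" "g \<in> fst d"
    using ex_atlas_chart g topspace_eq by blast
  note ch = atlas_subset[THEN holomorphic_charts_is_chart]
  show "complex_diff_at (local_rep (\<lambda>h. h \<otimes> g) c e) (snd c p)"
  proof (rule complex_diff_at_transform(1))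
    show "complex_diff_at ((snd e \<circ> (\<lambda>(x, y). x \<otimes> y) \<circ> chart_inv (prod_chart c d)) \<circ> (\<lambda>x. stack x (snd d g))) (snd c p)"
      using mult_complex_diff[OF c d(1) e p(1) d(2) p(2)] by (rule complex_diff_at_compose(1)[OF complex_diff_at_stack(2)])
    show "open (chart_image c)" "snd c p \<in> chart_image c"
      by (rule is_chartD(2)[OF ch[OF c]], rule chart_apply_in[OF p(1)])
    fix x assume x: "x \<in> chart_image c"
    show "((snd e \<circ> (\<lambda>(x, y). x \<otimes> y) \<circ> chart_inv (prod_chart c d)) \<circ> (\<lambda>x. stack x (snd d g))) x = local_rep (\<lambda>h. h \<otimes> g) c e x"
      using chart_inv_prod_chart[OF ch[OF c] ch[OF d(1)] chart_inv_in[OF x] d(2)]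
      by (simp add: chart_apply_inv[OF x] local_rep_def)
  qed
qed

end

section \<open>The connection of a left invariant metric\<close>

lemma norm_axis_complex: "norm (axis i t :: complex^'n::finite) = cmod t"
proof -
  have "(\<Sum>j\<in>UNIV. (cmod ((axis i t :: complex^'n) $ j))\<^sup>2) = (\<Sum>j\<in>UNIV. if j = i then (cmod t)\<^sup>2 else 0)"
    by (intro sum.cong) (auto simp: axis_def)
  then show ?thesis by (simp add: norm_vec_def L2_set_def)
qed

lemma bounded_linear_axis: "bounded_linear (\<lambda>t. axis k t :: complex^'n::finite)"
  unfolding linear_conv_bounded_linear[symmetric]
  by (simp add: linear_iff vec_eq_iff axis_def)

lemma axis_zero: "axis k 0 = 0"
  by (simp add: vec_eq_iff axis_def)

lemma has_derivative_vecI: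
  fixes f :: "'a::real_normed_vector \<Rightarrow> complex^'n::finite"
  assumes "\<And>i. ((\<lambda>x. f x $ i) has_derivative (\<lambda>x. f' x $ i)) (at a)"
  shows "(f has_derivative f') (at a)"
proof -
  have "((\<lambda>x. f x \<bullet> axis i b) has_derivative (\<lambda>x. f' x \<bullet> axis i b)) (at a)" for i b
    unfolding inner_axis by (rule has_derivative_inner_left[OF assms])
  then show ?thesis
    by (subst has_derivative_componentwise_within) (auto simp: Basis_vec_def)
qed

text \<open>Moving \<open>z\<close> along axis \<open>k\<close> and \<open>y\<close> along axis
  \<open>b\<close> turns each component of \<open>\<tau>\<close> into a function of two complex
  numbers that fits \<open>deriv_depends_holomorphically\<close>. \<open>C\<close> collects the
  derivatives of the Jacobian entries; it depends on \<open>z0\<close> and \<open>k\<close>, but not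
  on \<open>w\<close>.\<close>

lemma frame_derivative:
  fixes \<tau> :: "complex^'n::finite \<Rightarrow> complex^'n \<Rightarrow> complex^'n"
  assumes R: "0 < R"
    and cont: "continuous_on (ball z0 R \<times> ball z0 R) (\<lambda>x. \<tau> (fst x) (snd x))"
    and d2: "\<And>z y. z \<in> ball z0 R \<Longrightarrow> y \<in> ball z0 R \<Longrightarrow> complex_diff_at (\<tau> z) y"
    and d1: "\<And>z y. z \<in> ball z0 R \<Longrightarrow> y \<in> ball z0 R \<Longrightarrow> complex_diff_at (\<lambda>z. \<tau> z y) z"
  shows "\<exists>C. \<forall>w. ((\<lambda>t. frechet_derivative (\<tau> (z0 + axis k t)) (at z0) w)
    has_derivative (\<lambda>t. t *s (C *v w))) (at 0)"
proof -
  have ax: "t *s axis i 1 = (axis i t :: complex^'n)" for t i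
    by (simp add: vec_eq_iff axis_def)
  have nrm: "norm (axis i t :: complex^'n) = cmod t" for t i
    by (rule norm_axis_complex)
  have in_ball: "z0 + axis i t \<in> ball z0 R" if "t \<in> ball 0 R" for t i
    using that by (simp add: dist_norm nrm)
  define a where "a i b t = frechet_derivative (\<tau> (z0 + axis k t)) (at z0) (axis b 1) $ i" for i b t
  define \<psi> where "\<psi> i b t s = \<tau> (z0 + axis k t) (z0 + axis b s) $ i" for i b t s
  have psi2: "(\<psi> i b t has_field_derivative
      frechet_derivative (\<tau> (z0 + axis k t)) (at (z0 + axis b s)) (axis b 1) $ i) (at s)"
    if "t \<in> ball 0 R" "s \<in> ball 0 R" for i b t s
    using complex_diff_at_has_field_derivative[of "\<tau> (z0 + axis k t)" z0 s "axis b 1" i]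
      d2[OF in_ball in_ball, OF that]
    by (simp add: ax \<psi>_def[abs_def])
  have psi1: "\<exists>D. ((\<lambda>t. \<psi> i b t s) has_field_derivative D) (at t)"
    if "t \<in> ball 0 R" "s \<in> ball 0 R" for i b t s
    using complex_diff_at_has_field_derivative[of "\<lambda>z. \<tau> z (z0 + axis b s)" z0 t "axis k 1" i]
      d1[OF in_ball in_ball, OF that]
    by (auto simp: ax \<psi>_def[abs_def])
  have "(\<lambda>t. deriv (\<psi> i b t) 0) field_differentiable at 0" for i b
  proof (rule deriv_depends_holomorphically[OF R])
    have lin: "continuous_on S (\<lambda>t. axis i t :: complex^'n)" for S i
      by (rule linear_continuous_on[OF bounded_linear_axis])
    have "continuous_on (ball 0 R \<times> ball 0 R) (\<lambda>x. (z0 + axis k (fst x), z0 + axis b (snd x) :: complex^'n))"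
      by (intro continuous_intros continuous_on_compose2[OF lin[of UNIV]]) auto
    then have "continuous_on (ball 0 R \<times> ball 0 R)
        (\<lambda>x. \<tau> (fst (z0 + axis k (fst x), z0 + axis b (snd x))) (snd (z0 + axis k (fst x), z0 + axis b (snd x))))"
      by (rule continuous_on_compose2[OF cont]) (use in_ball in auto)
    then show "continuous_on (ball 0 R \<times> ball 0 R) (\<lambda>x. \<psi> i b (fst x) (snd x))"
      unfolding \<psi>_def by (intro continuous_on_component) simp
    show "\<psi> i b t holomorphic_on ball 0 R" if "t \<in> ball 0 R" for t
      using psi2[OF that] unfolding holomorphic_on_open[OF open_ball] by blast
    show "(\<lambda>t. \<psi> i b t s) holomorphic_on ball 0 R" if "s \<in> ball 0 R" for s
      using psi1[OF _ that] unfolding holomorphic_on_open[OF open_ball] by blast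
  qed
  then have "\<exists>D. ((\<lambda>t. deriv (\<psi> i b t) 0) has_field_derivative D) (at 0)" for i b
    by (simp add: field_differentiable_def)
  then obtain D where D: "\<And>i b. ((\<lambda>t. deriv (\<psi> i b t) 0) has_field_derivative D i b) (at 0)"
    by metis
  have "deriv (\<psi> i b t) 0 = a i b t" if "t \<in> ball 0 R" for i b t
    using DERIV_imp_deriv[OF psi2[OF that, of 0 i b]] R by (simp add: a_def axis_zero)
  then have a: "(a i b has_field_derivative D i b) (at 0)" for i b
    using R by (intro has_field_derivative_transform_within_open[OF D, where S = "ball 0 R"]) auto
  define C where "C = (\<chi> i b. D i b)"
  have "((\<lambda>t. frechet_derivative (\<tau> (z0 + axis k t)) (at z0) w) has_derivative (\<lambda>t. t *s (C *v w))) (at 0)" for w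
  proof -
    have "((\<lambda>t. \<chi> i. \<Sum>b\<in>UNIV. a i b t * w $ b) has_derivative (\<lambda>t. \<chi> i. \<Sum>b\<in>UNIV. t * D i b * w $ b)) (at 0)"
      using a unfolding has_field_derivative_def
      by (intro has_derivative_vecI) (simp, intro has_derivative_sum has_derivative_mult_left, simp add: mult_commute_abs)
    moreover have "(\<lambda>t. \<chi> i. \<Sum>b\<in>UNIV. t * D i b * w $ b) = (\<lambda>t. t *s (C *v w))"
      by (simp add: fun_eq_iff vec_eq_iff C_def matrix_vector_mult_def sum_distrib_left mult.assoc)
    ultimately have der: "((\<lambda>t. \<chi> i. \<Sum>b\<in>UNIV. a i b t * w $ b) has_derivative (\<lambda>t. t *s (C *v w))) (at 0)"
      by (simp only:)
    \<comment> \<open>Complex linearity of the differential is what allows it to be recovered from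
      the unit vectors alone.\<close>
    have eq: "(\<chi> i. \<Sum>b\<in>UNIV. a i b t * w $ b) = frechet_derivative (\<tau> (z0 + axis k t)) (at z0) w"
      if "t \<in> ball 0 R" for t
    proof -
      let ?D = "frechet_derivative (\<tau> (z0 + axis k t)) (at z0)"
      have cd: "complex_diff_at (\<tau> (z0 + axis k t)) z0" using d2[OF in_ball[OF that]] R by simp
      have lin: "linear ?D" using has_derivative_linear[OF complex_diff_at_derivative(1)[OF cd]] .
      have "?D w = ?D (\<Sum>b\<in>UNIV. w $ b *s axis b 1)" by (simp add: basis_expansion)
      also have "\<dots> = (\<Sum>b\<in>UNIV. w $ b *s ?D (axis b 1))"
        by (simp add: linear_sum[OF lin] complex_diff_at_derivative(2)[OF cd])
      finally show ?thesis by (simp add: vec_eq_iff a_def mult.commute)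
    qed
    have "(0 :: complex) \<in> ball 0 R" using R by simp
    from has_derivative_transform_within_open[OF der open_ball this eq] show ?thesis .
  qed
  then show ?thesis by blast
qed

text \<open>Differentiating the invariance of \<open>g\<close> along a holomorphic frame \<open>B\<close>: the antiholomorphic
  terms drop out of the Wirtinger derivative.\<close>

lemma d_z_of_invariant:
  fixes g :: "(complex^'n::finite) \<times> (complex^'n) \<Rightarrow> complex"
  assumes g: "g differentiable at (z0, w)" and R: "0 < R"
    and B: "((\<lambda>t. B (axis k t)) has_derivative (\<lambda>t. t *s u)) (at 0)" and B0: "B 0 = w"
    and inv: "\<And>z. z \<in> ball 0 R \<Longrightarrow> g (z0 + z, B z) = g (z0, w)"
  shows "d_z k g (z0, w) = - (\<Sum>i\<in>UNIV. u $ i * d_w i g (z0, w))"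
proof -
  define D where "D = frechet_derivative g (at (z0, w))"
  have D: "(g has_derivative D) (at (z0, w))"
    using g by (simp add: frechet_derivative_works D_def)
  have lin: "linear D" using has_derivative_linear[OF D] .
  interpret linear D by (rule lin)
  have "((\<lambda>t. z0 + axis k t) has_derivative (\<lambda>t. axis k t)) (at 0)"
    using has_derivative_add[OF has_derivative_const[of z0] bounded_linear_imp_has_derivative[OF bounded_linear_axis]] by simp
  from has_derivative_Pair[OF this B]
  have "((\<lambda>t. (z0 + axis k t, B (axis k t))) has_derivative (\<lambda>t. (axis k t, t *s u))) (at 0)" .
  moreover have "(g has_derivative D) (at (z0 + axis k 0, B (axis k 0)))"
    using D B0 by (simp add: axis_zero)
  ultimately have "((\<lambda>t. g (z0 + axis k t, B (axis k t))) has_derivative (\<lambda>t. D (axis k t, t *s u))) (at 0)"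
    by (rule has_derivative_compose)
  \<comment> \<open>By invariance \<open>g\<close> is constant along the moved vector, so horizontal
    and vertical parts of its derivative cancel.\<close>
  moreover have "((\<lambda>t. g (z0 + axis k t, B (axis k t))) has_derivative (\<lambda>t. 0)) (at 0)"
  proof (rule has_derivative_transform_within_open[where s = "ball 0 R" and f = "\<lambda>t. g (z0, w)"])
    fix t :: complex assume "t \<in> ball 0 R"
    then have "axis k t \<in> ball (0 :: complex^'n) R" by (simp add: norm_axis_complex)
    then show "g (z0, w) = g (z0 + axis k t, B (axis k t))" using inv by metis
  qed (use R in auto)
  ultimately have "(\<lambda>t. D (axis k t, t *s u)) = (\<lambda>t. 0)"
    by (rule has_derivative_unique)
  then have "D (axis k t, t *s u) = 0" for t by metis
  moreover have "D (axis k t, t *s u) = D (axis k t, 0) + D (0, t *s u)" for t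
    using add[of "(axis k t, 0)" "(0, t *s u)"] by simp
  ultimately have e: "D (axis k t, 0) = - D (0, t *s u)" for t
    by (metis add_eq_0_iff2 add.commute)
  have "linear (\<lambda>v. D (0, v))"
    using add[of "(0, _)" "(0, _)"] scale[of _ "(0, _)"] by (simp add: linear_iff)
  from wirtinger_sum[OF this, of u]
  have s: "D (0, u) - \<i> * D (0, \<i> *s u) = (\<Sum>i\<in>UNIV. u $ i * (D (0, axis i 1) - \<i> * D (0, axis i \<i>)))" .
  have dw: "2 * d_w i g (z0, w) = D (0, axis i 1) - \<i> * D (0, axis i \<i>)" for i
    by (simp add: d_w_def D_def[symmetric])
  \<comment> \<open>The values 1 and \<open>\<i>\<close> of \<open>t\<close> give the two real
    directions in \<open>d_z\<close>. Since the vertical velocity is \<open>t *s u\<close>, they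
    combine to the complex linear part of \<open>D\<close> at \<open>u\<close>.\<close>
  have "2 * d_z k g (z0, w) = - (D (0, u) - \<i> * D (0, \<i> *s u))"
    using e[of 1] e[of \<i>] by (simp add: d_z_def D_def[symmetric])
  also have "\<dots> = - (\<Sum>i\<in>UNIV. u $ i * (2 * d_w i g (z0, w)))"
    unfolding s dw ..
  also have "\<dots> = 2 * - (\<Sum>i\<in>UNIV. u $ i * d_w i g (z0, w))"
    by (simp add: sum_distrib_left algebra_simps)
  finally show ?thesis by simp
qed

section \<open>Left translations near a point and the connection they determine\<close>

context complex_Lie_group_locale
begin

lemma local_left_translations:
  assumes c: "c \<in> holomorphic_charts X A" and z0: "z0 \<in> chart_image c"
    and F: "left_invariant G X A F"
  obtains R \<tau> where "0 < R"
    and "continuous_on (ball z0 R \<times> ball z0 R) (\<lambda>x. \<tau> (fst x) (snd x))"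
    and "\<And>z y. z \<in> ball z0 R \<Longrightarrow> y \<in> ball z0 R \<Longrightarrow> complex_diff_at (\<tau> z) y"
    and "\<And>z y. z \<in> ball z0 R \<Longrightarrow> y \<in> ball z0 R \<Longrightarrow> complex_diff_at (\<lambda>z. \<tau> z y) z"
    and "\<And>y. y \<in> ball z0 R \<Longrightarrow> \<tau> z0 y = y"
    and "\<And>z w. z \<in> ball z0 R \<Longrightarrow>
      loc_G X A F c (z, frechet_derivative (\<tau> z) (at z0) w) = loc_G X A F c (z0, w)"
proof -
  define p where "p = chart_inv c"
  note ch = holomorphic_charts_is_chart[OF c]
  have pc: "p z \<in> fst c" "snd c (p z) = z" "p z \<in> carrier G" if "z \<in> chart_image c" for z
    using chart_inv_in[OF that] chart_apply_inv[OF that] chart_domain_subset[OF c] topspace_eq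
    by (auto simp: p_def)
  \<comment> \<open>The factor \<open>inv (p z0)\<close> normalizes the family: translation by
    \<open>p z \<otimes> inv (p z0)\<close> takes \<open>p z0\<close> to \<open>p z\<close> and is
    the identity for \<open>z = z0\<close>.\<close>
  define P where "P z y = p z \<otimes> inv (p z0) \<otimes> p y" for z y
  define U where "U = chart_image c"
  have U: "open U" using is_chartD(2)[OF ch] by (simp add: U_def)
  have g0: "inv (p z0) \<in> carrier G" using pc z0 by simp
  have pcont: "continuous_map (top_of_set U) X p"
    using chart_inv_continuous[OF ch] by (simp add: p_def U_def)
  have "continuous_map (top_of_set (U \<times> U)) X (\<lambda>x. p (fst x))"
       "continuous_map (top_of_set (U \<times> U)) X (\<lambda>x. p (snd x))"
  proof -
    have "continuous_map (top_of_set (U \<times> U)) (top_of_set U) fst"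
         "continuous_map (top_of_set (U \<times> U)) (top_of_set U) snd"
      by (auto simp: continuous_map_in_subtopology continuous_on_fst continuous_on_snd continuous_on_id)
    then show "continuous_map (top_of_set (U \<times> U)) X (\<lambda>x. p (fst x))"
       "continuous_map (top_of_set (U \<times> U)) X (\<lambda>x. p (snd x))"
      using continuous_map_compose[OF _ pcont, of "top_of_set (U \<times> U)" fst]
        continuous_map_compose[OF _ pcont, of "top_of_set (U \<times> U)" snd] by (simp_all only: o_def)
  qed
  then have Pcont: "continuous_map (top_of_set (U \<times> U)) X (\<lambda>x. P (fst x) (snd x))"
    unfolding P_def using g0 topspace_eq
    by (intro mult_continuous) (auto simp: continuous_map_const)
  \<comment> \<open>The product may leave the chart domain. \<open>W\<close> is an open
    neighbourhood of \<open>(z0, z0)\<close> where it does not, and supplies the radius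
    \<open>R\<close>.\<close>
  define W where "W = {x \<in> U \<times> U. P (fst x) (snd x) \<in> fst c}"
  have "openin (top_of_set (U \<times> U)) W"
    using openin_continuous_map_preimage[OF Pcont is_chartD(1)[OF ch]] by (simp add: W_def)
  then have "open W" using U openin_open_trans open_Times by blast
  have P0: "P z z0 = p z" "P z0 z = p z" if "z \<in> U" for z
    using pc[OF that[unfolded U_def]] pc[OF z0] by (simp_all add: P_def m_assoc)
  have "(z0, z0) \<in> W" using P0 z0 pc by (simp add: W_def U_def)
  then obtain S T where ST: "open S" "open T" "(z0, z0) \<in> S \<times> T" "S \<times> T \<subseteq> W"
    by (rule open_prod_elim[OF \<open>open W\<close>])
  then have "open (S \<inter> T)" "z0 \<in> S \<inter> T" by auto
  then obtain R where R: "0 < R" "ball z0 R \<subseteq> S \<inter> T"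
    by (rule openE)
  have inW: "(z, y) \<in> W" if "z \<in> ball z0 R" "y \<in> ball z0 R" for z y
    using that R ST by blast
  then have inU: "z \<in> U" if "z \<in> ball z0 R" for z using that by (auto simp: W_def)
  have PW: "P z y \<in> fst c" if "z \<in> ball z0 R" "y \<in> ball z0 R" for z y
    using inW[OF that] by (simp add: W_def)
  define \<tau> where "\<tau> z y = snd c (P z y)" for z y
  show thesis
  proof (rule that[of R \<tau>])
    show "0 < R" by (rule R)
    have "continuous_map (top_of_set (ball z0 R \<times> ball z0 R)) X (\<lambda>x. P (fst x) (snd x))"
      using inU by (intro continuous_map_from_subtopology_mono[OF Pcont]) auto
    then have "continuous_map (top_of_set (ball z0 R \<times> ball z0 R)) (subtopology X (fst c)) (\<lambda>x. P (fst x) (snd x))"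
      using PW by (auto simp: continuous_map_in_subtopology)
    from continuous_map_compose[OF this is_chartD(4)[OF ch]]
    show "continuous_on (ball z0 R \<times> ball z0 R) (\<lambda>x. \<tau> (fst x) (snd x))"
      by (simp add: o_def \<tau>_def)
    show "complex_diff_at (\<tau> z) y" if zy: "z \<in> ball z0 R" "y \<in> ball z0 R" for z y
    proof -
      have "p z \<otimes> inv (p z0) \<in> carrier G" using pc inU zy g0 by (auto simp: U_def)
      from left_translation_complex_diff[OF this c c, of "p y"]
      show ?thesis using PW[OF zy] pc inU[OF zy(2)]
        by (simp add: P_def U_def local_rep_def o_def p_def[symmetric] \<tau>_def[abs_def])
    qed
    show "complex_diff_at (\<lambda>z. \<tau> z y) z" if zy: "z \<in> ball z0 R" "y \<in> ball z0 R" for z y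
    proof (rule complex_diff_at_transform(1))
      have y: "p y \<in> carrier G" using pc inU zy by (auto simp: U_def)
      \<comment> \<open>Rebracketing turns the family, for fixed \<open>y\<close>, into one right
        translation of \<open>p x\<close>.\<close>
      have eq: "p x \<otimes> (inv (p z0) \<otimes> p y) = P x y" if "x \<in> U" for x
        using y g0 pc[of x] that by (simp add: P_def U_def m_assoc)
      show "complex_diff_at (local_rep (\<lambda>h. h \<otimes> (inv (p z0) \<otimes> p y)) c c) z"
        using right_translation_complex_diff[of "inv (p z0) \<otimes> p y", OF _ c c, of "p z"]
          PW[OF zy] eq[OF inU[OF zy(1)]] pc inU[OF zy(1)] y g0 by (simp add: U_def)
      show "open (ball z0 R)" "z \<in> ball z0 R" using zy by auto
      show "local_rep (\<lambda>h. h \<otimes> (inv (p z0) \<otimes> p y)) c c x = \<tau> x y" if "x \<in> ball z0 R" for x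
        using eq[OF inU[OF that]] by (simp add: local_rep_def p_def[symmetric] \<tau>_def)
    qed
    show "\<tau> z0 y = y" if "y \<in> ball z0 R" for y
      using P0(2)[OF inU[OF that]] pc inU[OF that] by (simp add: \<tau>_def U_def)
    show "loc_G X A F c (z, frechet_derivative (\<tau> z) (at z0) w) = loc_G X A F c (z0, w)"
      if z: "z \<in> ball z0 R" for z w
    proof -
      define g where "g = p z \<otimes> inv (p z0)"
      have g: "g \<in> carrier G" using pc inU z g0 by (auto simp: U_def g_def)
      have gp: "g \<otimes> p z0 = p z"
        using P0(1)[OF inU[OF z]] by (simp add: P_def g_def)
      have pz: "p z \<in> fst c" "snd c (p z) = z" using pc inU[OF z] by (auto simp: U_def)
      have "local_rep (\<lambda>h. g \<otimes> h) c c = \<tau> z"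
        by (simp add: fun_eq_iff local_rep_def \<tau>_def P_def g_def p_def)
      then have "pushforward X A X A (\<lambda>h. g \<otimes> h) (tvec_of_coords X A c (z0, w))
          = tvec_of_coords X A c (z, frechet_derivative (\<tau> z) (at z0) w)"
        using pushforward_tvec_of_coords[OF translation_continuous(1)[OF g]
            left_translation_complex_diff[OF g] c c z0, of w] gp pz
        by (simp add: p_def[symmetric])
      moreover have "F (pushforward X A X A (\<lambda>h. g \<otimes> h) (tvec_of_coords X A c (z0, w)))
          = F (tvec_of_coords X A c (z0, w))"
        using F g tvec_of_coords_in_T10[OF c z0] by (auto simp: left_invariant_def)
      ultimately show ?thesis by (simp add: loc_G_def)
    qed
  qed
qed

text \<open>The matrix \<open>C\<close> encodes the connection: \<open>N\<^sup>i\<^sub>k = - C\<^sup>i\<^sub>b w\<^sup>b\<close> over the point \<open>z0\<close>.\<close>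

lemma d_z_loc_G_linear:
  assumes c: "c \<in> holomorphic_charts X A" and z0: "z0 \<in> chart_image c"
    and F: "left_invariant G X A F"
    and smooth: "smooth_on (loc_G X A F c) (chart_image c \<times> (- {0}))"
  shows "\<exists>C. \<forall>w. w \<noteq> 0 \<longrightarrow>
    d_z k (loc_G X A F c) (z0, w) = - (\<Sum>i\<in>UNIV. (C *v w) $ i * d_w i (loc_G X A F c) (z0, w))"
proof -
  obtain R \<tau> where R: "0 < R"
    and \<tau>: "continuous_on (ball z0 R \<times> ball z0 R) (\<lambda>x. \<tau> (fst x) (snd x))"
    "\<And>z y. z \<in> ball z0 R \<Longrightarrow> y \<in> ball z0 R \<Longrightarrow> complex_diff_at (\<tau> z) y"
    "\<And>z y. z \<in> ball z0 R \<Longrightarrow> y \<in> ball z0 R \<Longrightarrow> complex_diff_at (\<lambda>z. \<tau> z y) z"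
    and id: "\<And>y. y \<in> ball z0 R \<Longrightarrow> \<tau> z0 y = y"
    and inv: "\<And>z w. z \<in> ball z0 R \<Longrightarrow>
      loc_G X A F c (z, frechet_derivative (\<tau> z) (at z0) w) = loc_G X A F c (z0, w)"
    using local_left_translations[OF c z0 F] by blast
  obtain C where C: "\<And>w. ((\<lambda>t. frechet_derivative (\<tau> (z0 + axis k t)) (at z0) w)
      has_derivative (\<lambda>t. t *s (C *v w))) (at 0)"
    using frame_derivative[OF R \<tau>] by blast
  have "((\<lambda>y. y) has_derivative (\<lambda>y. y)) (at z0)" by simp
  then have "(\<tau> z0 has_derivative (\<lambda>y. y)) (at z0)"
    by (rule has_derivative_transform_within_open[where s = "ball z0 R"]) (use R id in auto)
  \<comment> \<open>The frame starts at the identity, so the moved vector starts at \<open>w\<close>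
    itself.\<close>
  then have \<tau>0: "frechet_derivative (\<tau> z0) (at z0) = (\<lambda>y. y)"
    by (rule frechet_derivative_at[symmetric])
  have "d_z k (loc_G X A F c) (z0, w) = - (\<Sum>i\<in>UNIV. (C *v w) $ i * d_w i (loc_G X A F c) (z0, w))"
    if "w \<noteq> 0" for w
  proof (rule d_z_of_invariant[where B = "\<lambda>z. frechet_derivative (\<tau> (z0 + z)) (at z0) w", OF _ R C])
    show "loc_G X A F c differentiable at (z0, w)"
      using smooth_on_differentiable[OF smooth] z0 that by auto
    show "loc_G X A F c (z0 + z, frechet_derivative (\<tau> (z0 + z)) (at z0) w) = loc_G X A F c (z0, w)"
      if "z \<in> ball 0 R" for z
      using that by (intro inv) (simp add: dist_norm)
  qed (simp add: \<tau>0)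
  then show ?thesis by blast
qed

lemma left_invariant_Gamma:
  assumes c: "c \<in> holomorphic_charts X A" and z: "z \<in> chart_image c"
    and Fin: "complex_Finsler_metric X A F" and F: "left_invariant G X A F"
  shows "\<exists>C. \<forall>i j w. w \<noteq> 0 \<longrightarrow> Gamma_coeff X A F c i j k (z, w) = - C $ i $ j"
proof -
  let ?G = "loc_G X A F c"
  define S where "S = chart_image c \<times> (- {0 :: complex^'n})"
  have "open (chart_image c)" using is_chartD(2)[OF holomorphic_charts_is_chart[OF c]] .
  then have S: "open S" unfolding S_def by (intro open_Times) auto
  have smooth: "smooth_on ?G S"
    using Fin c \<open>open (chart_image c)\<close> unfolding S_def
    by (intro smooth_on_loc_G) (simp_all add: complex_Finsler_metric_def)
  have H: "hermitian_pos_def (levi_matrix X A F c x)" if "x \<in> S" for x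
  proof -
    obtain y w where x: "x = (y, w)" by (cases x)
    have "\<forall>z\<in>chart_image c. \<forall>w. w \<noteq> 0 \<longrightarrow> hermitian_pos_def (levi_matrix X A F c (z, w))"
      using Fin c by (simp add: complex_Finsler_metric_def)
    then show ?thesis using that by (simp add: x S_def)
  qed
  \<comment> \<open>Applying \<open>d_wbar\<close> to the formula for \<open>d_z\<close> produces
    derivatives in the order opposite to that in \<open>levi_matrix\<close>.\<close>
  have levi: "d_wbar j (d_w i ?G) x = levi_matrix X A F c x $ i $ j" if "x \<in> S" for i j x
  proof -
    have "levi_matrix X A F c x $ i $ j = cnj (levi_matrix X A F c x $ j $ i)"
      using H[OF that] unfolding hermitian_pos_def_def by blast
    then have "d_w i (d_wbar j ?G) x = cnj (d_w j (d_wbar i ?G) x)"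
      by (simp add: levi_matrix_def)
    then have "d_wbar j (d_w i ?G) x = d_w i (d_wbar j ?G) x"
      by (intro d_wbar_d_w_eq_levi[OF S that smooth]) (simp_all add: loc_G_def)
    then show ?thesis by (simp add: levi_matrix_def)
  qed
  obtain C where C: "\<And>w. w \<noteq> 0 \<Longrightarrow> d_z k ?G (z, w) = - (\<Sum>i\<in>UNIV. (C *v w) $ i * d_w i ?G (z, w))"
    using d_z_loc_G_linear[OF c z F smooth[unfolded S_def]] by blast
  have diff: "d_z k ?G differentiable at x" "d_w i ?G differentiable at x"
    "d_wbar j (d_z k ?G) differentiable at x" "d_w i (d_wbar j ?G) differentiable at x" if "x \<in> S" for i j x
    using smooth_on_wirtinger[OF S] smooth that smooth_on_differentiable by metis+
  have N: "N_coeff X A F c i k (z, w) = - (C *v w) $ i" if w: "w \<noteq> 0" for i w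
  proof -
    have zw: "(z, w) \<in> S" using z w by (simp add: S_def)
    define L where "L = levi_matrix X A F c (z, w)"
    have L: "L ** matrix_inv L = mat 1"
      using matrix_mult_matrix_inv[OF hermitian_pos_def_invertible[OF H[OF zw]]] by (simp add: L_def)
    have "d_wbar j (d_z k ?G) (z, w) = - (\<Sum>m\<in>UNIV. (C *v w) $ m * L $ m $ j)" for j
      using d_wbar_of_linear_combination[where g = "\<lambda>i. d_w i ?G", OF diff(1)[OF zw] w diff(2)[OF zw] C] levi[OF zw]
      by (simp add: L_def)
    \<comment> \<open>Summing over the conjugate index \<open>j\<close> pairs columns of
      \<open>L\<close> with rows of its inverse; what remains is the identity matrix.\<close>
    then have "N_coeff X A F c i k (z, w)
        = (\<Sum>j\<in>UNIV. \<Sum>m\<in>UNIV. - ((C *v w) $ m * (L $ m $ j * matrix_inv L $ j $ i)))"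
      unfolding N_coeff_def L_def[symmetric]
      by (simp add: sum_distrib_left sum_negf algebra_simps)
    also have "\<dots> = (\<Sum>m\<in>UNIV. - ((C *v w) $ m * (L ** matrix_inv L) $ m $ i))"
      by (subst sum.swap) (simp add: matrix_matrix_mult_def sum_distrib_left sum_negf)
    also have "\<dots> = - (C *v w) $ i"
      by (simp add: L mat_def if_distrib sum_negf cong: if_cong)
    finally show ?thesis .
  qed
  \<comment> \<open>This cannot be read off from the linear formula, whose matrix \<open>C\<close>
    was obtained for this \<open>z\<close> alone. Smoothness of \<open>G\<close> near
    \<open>(z, w)\<close> is used instead.\<close>
  have "N_coeff X A F c i k differentiable at (z, w)" if w: "w \<noteq> 0" for i w
  proof -
    have zw: "(z, w) \<in> S" using z w by (simp add: S_def)
    have "(\<lambda>x. matrix_inv (levi_matrix X A F c x) $ j $ i) differentiable at (z, w)" for j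
    proof (rule matrix_inv_differentiable[OF S zw])
      show "invertible (levi_matrix X A F c y)" if "y \<in> S" for y
        by (rule hermitian_pos_def_invertible[OF H[OF that]])
      show "(\<lambda>y. levi_matrix X A F c y $ i $ j) differentiable at (z, w)" for i j
        using diff(4)[OF zw, of i j] by (simp add: levi_matrix_def)
    qed
    then show ?thesis
      unfolding N_coeff_def[abs_def] using diff(3)[OF zw]
      by (intro differentiable_sum differentiable_mult) auto
  qed
  then have "Gamma_coeff X A F c i j k (z, w) = - C $ i $ j" if "w \<noteq> 0" for i j w
    unfolding Gamma_coeff_def using N that by (intro d_w_of_holomorphic_linear) auto
  then show ?thesis by blast
qed

end

theorem theorem1p1:
  fixes G :: "('a, 'b) monoid_scheme"
    and X :: "'a topology"
    and A :: "('a, 'n::finite) chart set"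
    and F :: "('a, 'n) tvec \<Rightarrow> real"
  assumes "complex_Lie_group G X A"
    and "complex_Finsler_metric X A F"
    and "left_invariant G X A F"
  shows "complex_Berwald X A F"
proof -
  interpret complex_Lie_group_locale G X A
    by unfold_locales (rule assms(1))
  show ?thesis
    unfolding complex_Berwald_def
  proof (intro ballI allI impI)
    fix c i j k z and w w' :: "complex^'n"
    assume c: "c \<in> holomorphic_charts X A" "z \<in> chart_image c" and w: "w \<noteq> 0" "w' \<noteq> 0"
    obtain C where "\<And>i j w. w \<noteq> 0 \<Longrightarrow> Gamma_coeff X A F c i j k (z, w) = - C $ i $ j"
      using left_invariant_Gamma[OF c assms(2,3)] by blast
    with w show "Gamma_coeff X A F c i j k (z, w) = Gamma_coeff X A F c i j k (z, w')" by simp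
  qed
qed

end
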